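(* Let $U=(U_{i,j})\in\prod_{1\le i<j\le k}M_{r_i,r_j}(\mathcal{O}(\mathbf{C}^*,0))$. Then there exists a unique pair $(\underline{F},V)$ with $\underline{F}=(F_{i,j})\in\prod_{1\le i<j\le k}M_{r_i,r_j}(\mathcal{O}(\mathbf{C}^*,0))$ and $V=(V_{i,j})\in\prod_{1\le i<j\le k}\mathcal{V}(r_i,r_j,\mu_i,\mu_j)$ such that the associated gauge transformation $F\in\mathfrak{G}(\mathcal{O}(\mathbf{C}^*,0))$ (with over-diagonal blocks $F_{i,j}$) defines an isomorphism from $A_U$ to $A_V$, i.e. $F[A_U]=A_V$.
   Context: Fix $q\in\mathbf{C}$ with $|q|>1$; $\sigma_q f(z)=f(qz)$, applied entrywise. $\mathcal{O}(\mathbf{C}^*,0)$ is the ring of germs of holomorphic functions in a punctured neighbourhood of $0$ (essential singularities at $0$ allowed). Fix integers $\mu_1>\cdots>\mu_k$, ranks $r_1,\dots,r_k\ge1$, matrices $A_i\in GL_{r_i}(\mathbf{C})$, $n=\sum r_i$. For a family $U=(U_{i,j})_{1\le i<j\le k}$ of $r_i\times r_j$ matrices, $A_U$ is the block upper triangular matrix with diagonal blocks $z^{-\mu_i}A_i$ and $(i,j)$-block $U_{i,j}$ for $i<j$. $\mathfrak{G}\subset GL_n$ is the group of block upper triangular matrices with diagonal blocks $I_{r_1},\dots,I_{r_k}$; $F[A]=(\sigma_qF)AF^{-1}$. For integers $\mu>\mu'$, $\mathcal{V}(r,r',\mu,\mu')$ is the space of $r\times r'$ matrices all of whose entries belong to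 $\sum_{\mu'\le l<\mu}\mathbf{C}z^l$. *)

theory Defs
  imports "HOL-Complex_Analysis.Complex_Analysis" "Jordan_Normal_Form.Matrix"
begin

no_notation fls_nth (infixl "$$" 75)

section \<open>Germs of holomorphic functions in a punctured neighbourhood of the origin\<close>

definition germ_rel :: "(complex \<Rightarrow> complex) \<Rightarrow> (complex \<Rightarrow> complex) \<Rightarrow> bool" where
  "germ_rel f g \<longleftrightarrow> isolated_singularity_at f 0 \<and> isolated_singularity_at g 0 \<and>
     (\<forall>\<^sub>F z in at 0. f z = g z)"

text \<open>
  The predicate \<^const>\<open>isolated_singularity_at\<close> only asks for analyticity on a punctured disc,
  so essential singularities are allowed. The value of a representative at the origin
  is irrelevant.
\<close>

quotient_type germ = "complex \<Rightarrow> complex" / partial: germ_rel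
proof (rule part_equivpI)
  show "\<exists>f. germ_rel f f"
    by (rule exI[of _ "\<lambda>_. 0"]) (simp add: germ_rel_def singularity_intros)
  show "symp germ_rel"
    by (auto simp: symp_def germ_rel_def elim: eventually_mono)
  show "transp germ_rel"
    by (auto simp: transp_def germ_rel_def elim: eventually_elim2)
qed

instantiation germ :: comm_ring_1
begin

lift_definition zero_germ :: germ is "\<lambda>_. 0"
  by (simp add: germ_rel_def singularity_intros)

lift_definition one_germ :: germ is "\<lambda>_. 1"
  by (simp add: germ_rel_def singularity_intros)

lift_definition plus_germ :: "germ \<Rightarrow> germ \<Rightarrow> germ" is "\<lambda>f g z. f z + g z"
  by (auto simp: germ_rel_def intro!: singularity_intros elim: eventually_elim2)

lift_definition minus_germ :: "germ \<Rightarrow> germ \<Rightarrow> germ" is "\<lambda>f g z. f z - g z"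
  by (auto simp: germ_rel_def intro!: singularity_intros elim: eventually_elim2)

lift_definition uminus_germ :: "germ \<Rightarrow> germ" is "\<lambda>f z. - f z"
  by (auto simp: germ_rel_def intro!: singularity_intros elim: eventually_mono)

lift_definition times_germ :: "germ \<Rightarrow> germ \<Rightarrow> germ" is "\<lambda>f g z. f z * g z"
  by (auto simp: germ_rel_def intro!: singularity_intros elim: eventually_elim2)

instance
proof
  fix a b c :: germ
  show "a * b * c = a * (b * c)"
    by transfer (auto simp: germ_rel_def mult.assoc intro!: singularity_intros)
  show "a * b = b * a"
    by transfer (auto simp: germ_rel_def mult.commute intro!: singularity_intros)
  show "1 * a = a"
    by transfer (auto simp: germ_rel_def)
  show "a + b + c = a + (b + c)"
    by transfer (auto simp: germ_rel_def add.assoc intro!: singularity_intros)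
  show "a + b = b + a"
    by transfer (auto simp: germ_rel_def add.commute intro!: singularity_intros)
  show "0 + a = a"
    by transfer (auto simp: germ_rel_def)
  show "- a + a = 0"
    by transfer (auto simp: germ_rel_def intro!: singularity_intros)
  show "a - b = a + - b"
    by transfer (auto simp: germ_rel_def intro!: singularity_intros)
  show "(a + b) * c = a * c + b * c"
    by transfer (auto simp: germ_rel_def algebra_simps intro!: singularity_intros)
  show "(0::germ) \<noteq> 1"
    by transfer (auto simp: germ_rel_def)
qed

end

lift_definition germ_const :: "complex \<Rightarrow> germ" is "\<lambda>c _. c"
  by (simp add: germ_rel_def singularity_intros)

lift_definition germ_zpow :: "int \<Rightarrow> germ" is "\<lambda>m z. z powi m"
  by (auto simp: germ_rel_def eventually_at_filter intro!: singularity_intros)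

lemma filterlim_mult_at_0:
  fixes q :: complex
  assumes "q \<noteq> 0"
  shows "filterlim (\<lambda>z. q * z) (at 0) (at 0)"
proof -
  have "((\<lambda>z. q * z) \<longlongrightarrow> q * 0) (at 0)"
    by (intro tendsto_intros)
  with assms show ?thesis
    by (auto simp: filterlim_at eventually_at_filter)
qed

lemma isolated_singularity_at_scale:
  assumes "isolated_singularity_at f 0" "q \<noteq> 0"
  shows "isolated_singularity_at (\<lambda>z. f (q * z)) 0"
proof -
  obtain r where r: "r > 0" "f analytic_on ball 0 r - {0}"
    using assms(1) by (auto simp: isolated_singularity_at_def)
  have "(f \<circ> (\<lambda>z. q * z)) analytic_on ball 0 (r / norm q) - {0}"
  proof (rule analytic_on_compose_gen[where T = "ball 0 r - {0}"])
    show "(\<lambda>z. q * z) analytic_on ball 0 (r / norm q) - {0}"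
      by (intro analytic_intros)
    show "f analytic_on ball 0 r - {0}" by fact
    show "q * z \<in> ball 0 r - {0}" if "z \<in> ball 0 (r / norm q) - {0}" for z
      using that assms(2) by (auto simp: norm_mult field_simps)
  qed
  moreover have "r / norm q > 0" using r assms by simp
  ultimately show ?thesis
    unfolding isolated_singularity_at_def comp_def by blast
qed

text \<open>
  The dilatation operator \<open>\<sigma>\<^sub>q f(z) = f(q z)\<close>. It does not act on germs for \<open>q = 0\<close>, where it is
  set to the identity.
\<close>

lift_definition sigma :: "complex \<Rightarrow> germ \<Rightarrow> germ" is
  "\<lambda>q f. if q = 0 then f else (\<lambda>z. f (q * z))"
  by (auto simp: germ_rel_def isolated_singularity_at_scale
           intro: eventually_compose_filterlim[OF _ filterlim_mult_at_0])


section \<open>Block matrices\<close>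

text \<open>
  Blocks are numbered \<open>1, \<dots>, k\<close>, whereas entries of a matrix are numbered from \<open>0\<close>.
  For \<open>a < r 1 + \<dots> + r k\<close>, the index \<open>a\<close> is the \<open>block_pos r a\<close>-th one of block \<open>block_of r a\<close>.
\<close>

definition block_of :: "(nat \<Rightarrow> nat) \<Rightarrow> nat \<Rightarrow> nat" where
  "block_of r a = (LEAST i. a < (\<Sum>l=1..i. r l))"

definition block_pos :: "(nat \<Rightarrow> nat) \<Rightarrow> nat \<Rightarrow> nat" where
  "block_pos r a = a - (\<Sum>l=1..<block_of r a. r l)"

definition block_mat :: "(nat \<Rightarrow> nat) \<Rightarrow> nat \<Rightarrow> (nat \<Rightarrow> nat \<Rightarrow> 'a mat) \<Rightarrow> 'a mat" where
  "block_mat r k B = mat (\<Sum>l=1..k. r l) (\<Sum>l=1..k. r l)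
     (\<lambda>(a, b). B (block_of r a) (block_of r b) $$ (block_pos r a, block_pos r b))"

definition upper_block_mat ::
    "(nat \<Rightarrow> nat) \<Rightarrow> nat \<Rightarrow> (nat \<Rightarrow> 'a mat) \<Rightarrow> (nat \<times> nat \<Rightarrow> 'a mat) \<Rightarrow> 'a :: zero mat" where
  "upper_block_mat r k D U = block_mat r k
     (\<lambda>i j. if i = j then D i else if i < j then U (i, j) else 0\<^sub>m (r i) (r j))"

definition upper_pairs :: "nat \<Rightarrow> (nat \<times> nat) set" where
  "upper_pairs k = {(i, j). 1 \<le> i \<and> i < j \<and> j \<le> k}"

text \<open>
  Families indexed by pairs \<open>i < j\<close> are extensional functions, so that equality of
  families is equality of functions.
\<close>

definition block_families :: "(nat \<Rightarrow> nat) \<Rightarrow> nat \<Rightarrow> (nat \<times> nat \<Rightarrow> 'a mat) set" where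
  "block_families r k = (\<Pi>\<^sub>E (i, j) \<in> upper_pairs k. carrier_mat (r i) (r j))"

definition unipotent_group :: "(nat \<Rightarrow> nat) \<Rightarrow> nat \<Rightarrow> 'a :: {zero, one} mat set" where
  "unipotent_group r k = {M \<in> carrier_mat (\<Sum>l=1..k. r l) (\<Sum>l=1..k. r l).
     \<forall>a < (\<Sum>l=1..k. r l). \<forall>b < (\<Sum>l=1..k. r l).
       (block_of r b < block_of r a \<longrightarrow> M $$ (a, b) = 0) \<and>
       (block_of r a = block_of r b \<longrightarrow> M $$ (a, b) = (if a = b then 1 else 0))}"

definition unipotent_mat ::
    "(nat \<Rightarrow> nat) \<Rightarrow> nat \<Rightarrow> (nat \<times> nat \<Rightarrow> 'a mat) \<Rightarrow> 'a :: {zero, one} mat" where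
  "unipotent_mat r k F = upper_block_mat r k (\<lambda>i. 1\<^sub>m (r i)) F"


section \<open>\<open>q\<close>-difference systems\<close>

text \<open>The matrix \<open>A\<^sub>U\<close>, with diagonal blocks \<open>z\<^bsup>-\<mu>\<^sub>i\<^esup> A\<^sub>i\<close>.\<close>

definition system_mat :: "(nat \<Rightarrow> nat) \<Rightarrow> nat \<Rightarrow> (nat \<Rightarrow> int) \<Rightarrow> (nat \<Rightarrow> complex mat) \<Rightarrow>
    (nat \<times> nat \<Rightarrow> germ mat) \<Rightarrow> germ mat" where
  "system_mat r k \<mu> A U =
     upper_block_mat r k (\<lambda>i. germ_zpow (- \<mu> i) \<cdot>\<^sub>m map_mat germ_const (A i)) U"

text \<open>
  The gauge transform \<open>F[A] = (\<sigma>\<^sub>q F) A F\<^sup>-\<^sup>1\<close>, meaningful for \<open>F\<close> invertible over the ring of germs.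
\<close>

definition gauge_transform :: "complex \<Rightarrow> germ mat \<Rightarrow> germ mat \<Rightarrow> germ mat" where
  "gauge_transform q F A = map_mat (sigma q) F * A * inv\<^bsub>ring_mat TYPE(germ) (dim_row F) ()\<^esub> F"

text \<open>
  The space of \<open>m \<times> n\<close> matrices with entries in the span of the \<open>z\<^sup>l\<close>, \<open>\<nu> \<le> l < \<mu>\<close>.
\<close>

definition normal_form_space :: "nat \<Rightarrow> nat \<Rightarrow> int \<Rightarrow> int \<Rightarrow> germ mat set" where
  "normal_form_space m n \<mu> \<nu> = {M \<in> carrier_mat m n. \<forall>a<m. \<forall>b<n.
     \<exists>c :: int \<Rightarrow> complex. M $$ (a, b) = (\<Sum>l\<in>{\<nu>..<\<mu>}. germ_const (c l) * germ_zpow l)}"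

definition normal_form_families ::
    "(nat \<Rightarrow> nat) \<Rightarrow> nat \<Rightarrow> (nat \<Rightarrow> int) \<Rightarrow> (nat \<times> nat \<Rightarrow> germ mat) set" where
  "normal_form_families r k \<mu> =
     (\<Pi>\<^sub>E (i, j) \<in> upper_pairs k. normal_form_space (r i) (r j) (\<mu> i) (\<mu> j))"

end

theory Submission
  imports Defs "Jordan_Normal_Form.Determinant"
begin

text \<open>
  Write the gauge equation as \<open>(\<sigma>\<^sub>q F) A\<^sub>U = A\<^sub>V F\<close>, which is legitimate because a block unipotent
  matrix over the ring of germs has determinant \<open>1\<close>. Its \<open>(i, j)\<close> block, \<open>i < j\<close>, reads
  \<open>(\<sigma>\<^sub>q X) z\<^bsup>-\<mu>\<^sub>j\<^esup> A\<^sub>j + W = z\<^bsup>-\<mu>\<^sub>i\<^esup> A\<^sub>i X + Y\<close> with \<open>X = F\<^sub>i\<^sub>j\<close> and \<open>Y = V\<^sub>i\<^sub>j\<close>, where \<open>W\<close> only involves \<open>U\<close> and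
  blocks of \<open>F\<close> and \<open>V\<close> that lie strictly closer to the diagonal (\<open>gauge_equation_iff_blocks\<close>). So
  everything follows, by well-founded recursion on \<open>j - i\<close>, once this equation is known to have
  exactly one solution \<open>(X, Y)\<close> for every \<open>W\<close> (\<open>two_block_normal_form\<close>).

  Put \<open>\<mu> = \<mu>\<^sub>i > \<nu> = \<mu>\<^sub>j\<close>, \<open>A = A\<^sub>i\<close>, \<open>B = A\<^sub>j\<close> and compare the coefficients of \<open>z\<^sup>n\<close>:
  \<open>q\<^bsup>n+\<nu>\<^esup> X\<^bsub>n+\<nu>\<^esub> B + W\<^bsub>n\<^esub> = A X\<^bsub>n+\<mu>\<^esub> + Y\<^bsub>n\<^esub>\<close>.
  The matrix \<open>Y\<^bsub>n\<^esub>\<close> vanishes unless \<open>\<nu> \<le> n < \<mu>\<close>, and is otherwise free; hence the equations in this window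
  merely define \<open>Y\<close>. Those with \<open>n \<ge> \<mu>\<close> involve only the \<open>X\<^bsub>m\<^esub>\<close> with \<open>m \<ge> \<mu> + \<nu>\<close>, those with \<open>n < \<nu>\<close> only
  the \<open>X\<^bsub>m\<^esub>\<close> with \<open>m < \<mu> + \<nu>\<close>: the problem splits into two independent half-line recurrences.

  Read from infinity towards the middle, both express \<open>X\<^bsub>m\<^esub>\<close> through the entry \<open>\<mu> - \<nu>\<close> steps further
  out, multiplied by a factor that decays like \<open>|q|\<^bsup>-|m|\<^esup>\<close>. Iterating it \<open>j\<close> times produces, up to a
  geometric factor, \<open>|q|\<^bsup>-j(j-1)/2\<^esup>\<close>, which beats every geometric growth. So among sequences of at most
  geometric growth there is exactly one solution, given by a convergent series, and it obeys each
  geometric bound that \<open>W\<close> obeys (\<open>damped_shift_solution\<close>, \<open>damped_shift_fixed_point_eq_0\<close>). Finally,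
  germs of functions with an isolated, possibly essential, singularity at \<open>0\<close> correspond exactly to
  the two-sided sequences \<open>a\<close> such that, for some \<open>R > 0\<close>, the numbers \<open>a\<^bsub>n\<^esub> \<rho>\<^sup>n\<close> are bounded for every
  \<open>\<rho> \<in> (0, R)\<close> (\<open>germ_eqI\<close>, \<open>laurent_coeff_bounded\<close>, \<open>laurent_coeff_surj\<close>), so that the
  sequences found are Laurent expansions of germs.
\<close>

section \<open>Laurent expansions at an isolated singularity\<close>

lemma has_contour_integral_powi_circlepath:
  assumes "\<rho> > 0"
  shows "((\<lambda>z. z powi m) has_contour_integral (if m = -1 then 2 * pi * \<i> else 0)) (circlepath 0 \<rho>)"
proof (cases "m = -1")
  case True
  have "((\<lambda>z. z powi m) has_contour_integral 2 * pi * \<i> * residue (\<lambda>z. z powi m) 0) (circlepath 0 \<rho>)"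
    using assms by (intro base_residue[of UNIV]) (auto intro!: holomorphic_intros)
  moreover have "residue (\<lambda>z. z powi m) 0 = 1"
    using residue_simple[of UNIV 0 "\<lambda>_. 1"] True by (simp add: power_int_def divide_inverse)
  ultimately show ?thesis using True by simp
next
  case False
  have "((\<lambda>z. z powi m) has_contour_integral 0) (circlepath 0 \<rho>)"
  proof (rule Cauchy_theorem_primitive[where S = "-{0}" and f = "\<lambda>z. z powi (m + 1) / of_int (m + 1)"])
    fix z :: complex assume z: "z \<in> -{0}"
    have nz: "of_int (m + 1) \<noteq> (0::complex)" using False by (subst of_int_eq_0_iff) auto
    show "((\<lambda>z. z powi (m + 1) / of_int (m + 1)) has_field_derivative z powi m) (at z within -{0})"
      using z nz by (auto intro!: derivative_eq_intros simp del: of_int_add simp: divide_simps)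
  qed (use assms in auto)
  with False show ?thesis by simp
qed

text \<open>
  Termwise integration. Sums are unconditional and over an arbitrary index set, so that one statement
  serves power series as well as series indexed by the integers.
\<close>

lemma has_sum_contour_integral_circlepath:
  assumes "\<rho> > 0"
    and int: "\<And>n. n \<in> N \<Longrightarrow> (g n has_contour_integral J n) (circlepath 0 \<rho>)"
    and bound: "\<And>n z. n \<in> N \<Longrightarrow> norm z = \<rho> \<Longrightarrow> norm (g n z) \<le> M n"
    and "M summable_on N"
    and sum: "\<And>z. norm z = \<rho> \<Longrightarrow> ((\<lambda>n. g n z) has_sum G z) N"
  shows "G contour_integrable_on circlepath 0 \<rho>"
    and "(J has_sum contour_integral (circlepath 0 \<rho>) G) N"
proof -
  let ?F = "finite_subsets_at_top N"
  have ul: "uniform_limit (sphere 0 \<rho>) (\<lambda>X z. \<Sum>n\<in>X. g n z) G ?F"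
    by (rule Weierstrass_m_test_general'[where M = M]) (use assms in \<open>auto simp: dist_norm\<close>)
  have I: "((\<lambda>z. \<Sum>n\<in>X. g n z) has_contour_integral (\<Sum>n\<in>X. J n)) (circlepath 0 \<rho>)"
    if "finite X" "X \<subseteq> N" for X
    by (rule has_contour_integral_sum) (use that int in auto)
  have ev: "\<forall>\<^sub>F X in ?F. finite X \<and> X \<subseteq> N"
    by (auto intro: eventually_finite_subsets_at_top_weakI)
  have ev1: "\<forall>\<^sub>F X in ?F. (\<lambda>z. \<Sum>n\<in>X. g n z) contour_integrable_on circlepath 0 \<rho>"
    by (rule eventually_mono[OF ev]) (use I in \<open>auto simp: contour_integrable_on_def\<close>)
  show "G contour_integrable_on circlepath 0 \<rho>"
    by (rule contour_integral_uniform_limit_circlepath(1)[OF ev1 ul]) (use assms in auto)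
  have "((\<lambda>X. contour_integral (circlepath 0 \<rho>) (\<lambda>z. \<Sum>n\<in>X. g n z))
      \<longlongrightarrow> contour_integral (circlepath 0 \<rho>) G) ?F"
    by (rule contour_integral_uniform_limit_circlepath(2)[OF ev1 ul]) (use assms in auto)
  moreover have "\<forall>\<^sub>F X in ?F. contour_integral (circlepath 0 \<rho>) (\<lambda>z. \<Sum>n\<in>X. g n z) = sum J X"
    by (rule eventually_mono[OF ev]) (use I in \<open>auto intro: contour_integral_unique\<close>)
  ultimately show "(J has_sum contour_integral (circlepath 0 \<rho>) G) N"
    unfolding has_sum_def by (rule Lim_transform_eventually)
qed

definition fun_laurent_coeff :: "(complex \<Rightarrow> complex) \<Rightarrow> int \<Rightarrow> complex" where
  "fun_laurent_coeff f n = residue (\<lambda>z. f z * z powi (-n-1)) 0"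

lemma has_contour_integral_laurent_coeff:
  assumes "f holomorphic_on ball 0 R - {0}" "0 < \<rho>" "\<rho> < R"
  shows "((\<lambda>z. f z * z powi (-n-1)) has_contour_integral 2 * pi * \<i> * fun_laurent_coeff f n) (circlepath 0 \<rho>)"
  unfolding fun_laurent_coeff_def
  by (rule base_residue[of "ball 0 R"]) (use assms in \<open>auto intro!: holomorphic_intros\<close>)

lemma laurent_series_norm_summable:
  fixes f :: "complex \<Rightarrow> complex"
  assumes "\<And>z. z \<noteq> 0 \<Longrightarrow> norm z < R \<Longrightarrow> ((\<lambda>n. a n * z powi n) has_sum f z) UNIV"
    and "0 < \<rho>" "\<rho> < R"
  shows "(\<lambda>n. norm (a n) * \<rho> powi n) summable_on UNIV"
proof -
  have "(\<lambda>n. a n * complex_of_real \<rho> powi n) summable_on UNIV"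
    using assms(1)[of "complex_of_real \<rho>"] assms(2,3) by (auto simp: summable_on_def)
  then have "(\<lambda>n. norm (a n * complex_of_real \<rho> powi n)) summable_on UNIV"
    by (simp add: summable_on_iff_abs_summable_on_complex)
  then show ?thesis
    using assms by (simp add: norm_mult norm_power_int)
qed

text \<open>
  A Laurent series converges uniformly on closed annuli: its terms are dominated there by the sum
  of their norms on the two boundary circles. So the sum is holomorphic, and it can be
  integrated against \<open>z\<^bsup>-m-1\<^esup>\<close> term by term.
\<close>

lemma laurent_series_unique:
  fixes a :: "int \<Rightarrow> complex" and f :: "complex \<Rightarrow> complex"
  assumes "\<And>z. z \<noteq> 0 \<Longrightarrow> norm z < R \<Longrightarrow> ((\<lambda>n. a n * z powi n) has_sum f z) UNIV"
    and R: "R > 0"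
  shows "f holomorphic_on ball 0 R - {0}" and "fun_laurent_coeff f m = a m"
proof -
  note hs = assms(1)
  have sm: "(\<lambda>n. norm (a n) * \<rho> powi n) summable_on UNIV" if "0 < \<rho>" "\<rho> < R" for \<rho>
    using laurent_series_norm_summable[of R a f \<rho>] hs that by blast
  have powi_le: "norm z powi n \<le> \<rho>1 powi n + \<rho>2 powi n"
    if "0 < \<rho>1" "\<rho>1 \<le> norm z" "norm z \<le> \<rho>2" for \<rho>1 \<rho>2 and z :: complex and n :: int
  proof (cases "n \<ge> 0")
    case True
    have "norm z powi n \<le> \<rho>2 powi n"
      using that True by (intro power_int_mono) auto
    then show ?thesis using that by (simp add: add_increasing)
  next
    case False
    have "norm z powi n \<le> \<rho>1 powi n"
      using that False by (intro power_int_antimono) auto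
    then show ?thesis using that by (smt (verit) zero_le_power_int)
  qed
  show holo: "f holomorphic_on ball 0 R - {0}"
    unfolding holomorphic_on_def
  proof (rule ballI)
    fix w :: complex assume w: "w \<in> ball 0 R - {0}"
    define e where "e = min (norm w) (R - norm w) / 2"
    have e: "e > 0" "e < norm w" "norm w + e < R"
      using w by (auto simp: e_def min_def field_simps)
    have annulus: "norm w - e \<le> norm z \<and> norm z \<le> norm w + e \<and> z \<noteq> 0" if "z \<in> cball w e" for z
    proof -
      have "norm (z - w) \<le> e" using that by (simp add: dist_norm norm_minus_commute)
      then show ?thesis
        using norm_triangle_ineq2[of w z] norm_triangle_ineq2[of z w] e
        by (auto simp: norm_minus_commute)
    qed
    have ul: "uniform_limit (cball w e) (\<lambda>X z. \<Sum>n\<in>X. a n * z powi n) f (finite_subsets_at_top UNIV)"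
    proof (rule Weierstrass_m_test_general')
      show "(\<lambda>n. norm (a n) * (norm w - e) powi n + norm (a n) * (norm w + e) powi n) summable_on UNIV"
        by (intro summable_on_add sm) (use e in auto)
      show "norm (a n * z powi n) \<le> norm (a n) * (norm w - e) powi n + norm (a n) * (norm w + e) powi n"
        if "z \<in> cball w e" for n z
        using powi_le[of "norm w - e" z "norm w + e" n] annulus[OF that] e
        by (simp add: norm_mult norm_power_int mult_left_mono flip: distrib_left)
      show "((\<lambda>n. a n * z powi n) has_sum f z) UNIV" if "z \<in> cball w e" for z
        using annulus[OF that] e by (intro hs) auto
    qed
    have "f holomorphic_on ball w e"
    proof (rule holomorphic_uniform_limit[OF _ ul])
      show "\<forall>\<^sub>F X in finite_subsets_at_top UNIV. continuous_on (cball w e) (\<lambda>z. \<Sum>n\<in>X. a n * z powi n)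
          \<and> (\<lambda>z. \<Sum>n\<in>X. a n * z powi n) holomorphic_on ball w e"
        using annulus by (intro always_eventually allI conjI continuous_intros holomorphic_intros) auto
    qed auto
    then show "f field_differentiable at w within ball 0 R - {0}"
      using e by (meson centre_in_ball field_differentiable_at_within holomorphic_on_imp_differentiable_at open_ball)
  qed
  define \<rho> where "\<rho> = R / 2"
  have \<rho>: "0 < \<rho>" "\<rho> < R" using R by (auto simp: \<rho>_def)
  have "((\<lambda>n. a n * (if n - m - 1 = -1 then 2 * pi * \<i> else 0)) has_sum
      contour_integral (circlepath 0 \<rho>) (\<lambda>z. f z * z powi (-m-1))) UNIV"
  proof (rule has_sum_contour_integral_circlepath(2)[OF \<rho>(1)])
    show "((\<lambda>z. a n * z powi (n - m - 1)) has_contour_integral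
        a n * (if n - m - 1 = -1 then 2 * pi * \<i> else 0)) (circlepath 0 \<rho>)" for n
      by (intro has_contour_integral_lmul has_contour_integral_powi_circlepath \<rho>)
    show "norm (a n * z powi (n - m - 1)) \<le> norm (a n) * \<rho> powi n * \<rho> powi (-m-1)"
      if "norm z = \<rho>" for n z
    proof -
      have "\<rho> powi (n - m - 1) = \<rho> powi n * \<rho> powi (-m-1)"
        using power_int_add[of \<rho> n "-m-1"] \<rho> by (simp add: algebra_simps)
      then show ?thesis using that by (simp add: norm_mult norm_power_int)
    qed
    show "(\<lambda>n. norm (a n) * \<rho> powi n * \<rho> powi (-m-1)) summable_on UNIV"
      by (intro summable_on_cmult_left sm \<rho>)
    show "((\<lambda>n. a n * z powi (n - m - 1)) has_sum f z * z powi (-m-1)) UNIV"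
      if "norm z = \<rho>" for z
    proof -
      have "z \<noteq> 0" using that \<rho> by auto
      then have "a n * z powi (n - m - 1) = a n * z powi n * z powi (-m-1)" for n
        using power_int_add[of z n "-m-1"] by (simp add: algebra_simps)
      moreover have "((\<lambda>n. a n * z powi n * z powi (-m-1)) has_sum f z * z powi (-m-1)) UNIV"
        by (intro has_sum_cmult_left hs) (use \<open>z \<noteq> 0\<close> that \<rho> in auto)
      ultimately show ?thesis by (simp only:)
    qed
  qed
  moreover have "((\<lambda>n. a n * (if n - m - 1 = -1 then 2 * pi * \<i> else 0)) has_sum a m * (2 * pi * \<i>)) UNIV"
    using has_sum_finite_neutralI[of "{m}" UNIV "\<lambda>n. a n * (if n - m - 1 = -1 then 2 * pi * \<i> else 0)"]
    by simp
  ultimately have "contour_integral (circlepath 0 \<rho>) (\<lambda>z. f z * z powi (-m-1)) = a m * (2 * pi * \<i>)"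
    by (rule has_sum_unique)
  with contour_integral_unique[OF has_contour_integral_laurent_coeff[OF holo \<rho>, of m]]
  show "fun_laurent_coeff f m = a m" by simp
qed

text \<open>
  Cauchy's formula for an annulus around \<open>0\<close> writes \<open>f w\<close> as a difference of two Cauchy integrals.
  Expanding the Cauchy kernel in powers of \<open>w / z\<close> on the outer circle yields the terms with \<open>n \<ge> 0\<close>,
  in powers of \<open>z / w\<close> on the inner one those with \<open>n < 0\<close>.
\<close>

lemma laurent_expansion:
  assumes holo: "f holomorphic_on ball 0 R - {0}" and w: "w \<noteq> 0" "norm w < R"
  shows "((\<lambda>n. fun_laurent_coeff f n * w powi n) has_sum f w) UNIV"
proof -
  define r1 where "r1 = norm w / 2"
  define r2 where "r2 = (norm w + R) / 2"
  have r: "0 < r1" "r1 < norm w" "norm w < r2" "r2 < R" "r1 < R" "0 < r2"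
  proof -
    have "norm w > 0" using w by simp
    moreover have "0 < x / 2 \<and> x / 2 < x \<and> x < (x + R) / 2 \<and> (x + R) / 2 < R \<and> x / 2 < R \<and> 0 < (x + R) / 2"
      if "0 < x" "x < R" for x :: real
      using that by auto
    ultimately show "0 < r1" "r1 < norm w" "norm w < r2" "r2 < R" "r1 < R" "0 < r2"
      using w(2) unfolding r1_def r2_def by blast+
  qed
  define c where "c = 2 * pi * \<i>"
  have c: "c \<noteq> 0" by (simp add: c_def)
  have bdd: "\<exists>B. \<forall>z. norm z = \<rho> \<longrightarrow> norm (f z) \<le> B" if "0 < \<rho>" "\<rho> < R" for \<rho>
  proof -
    have "continuous_on (sphere 0 \<rho>) f"
      by (rule continuous_on_subset[OF holomorphic_on_imp_continuous_on[OF holo]]) (use that in auto)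
    then have "bounded (f ` sphere 0 \<rho>)"
      by (intro compact_imp_bounded compact_continuous_image) auto
    then obtain B where B: "\<And>z. z \<in> f ` sphere 0 \<rho> \<Longrightarrow> norm z \<le> B"
      by (auto simp: bounded_iff)
    then have "norm (f z) \<le> B" if "norm z = \<rho>" for z
      using that by simp
    then show ?thesis by blast
  qed
  obtain B1 where B1: "norm (f z) \<le> B1" if "norm z = r1" for z
    using bdd[of r1] r by blast
  obtain B2 where B2: "norm (f z) \<le> B2" if "norm z = r2" for z
    using bdd[of r2] r by blast
  have geo: "((\<lambda>n. x ^ n) has_sum 1 / (1 - x)) UNIV" if "norm x < 1" for x :: complex
    by (rule norm_summable_imp_has_sum)
       (use that in \<open>auto simp: norm_power intro!: summable_geometric geometric_sums\<close>)
  have geo': "(\<lambda>n. x ^ n) summable_on UNIV" if "0 \<le> x" "x < 1" for x :: real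
    by (rule norm_summable_imp_summable_on) (use that in \<open>auto intro!: summable_geometric\<close>)
  have outer_int: "(\<lambda>z. f z / (z - w)) contour_integrable_on circlepath 0 r2"
    and outer: "((\<lambda>n. c * fun_laurent_coeff f (int n) * w ^ n) has_sum
      contour_integral (circlepath 0 r2) (\<lambda>z. f z / (z - w))) UNIV"
  proof -
    have 1: "((\<lambda>z. f z * z powi (-int n-1) * w ^ n) has_contour_integral c * fun_laurent_coeff f (int n) * w ^ n)
        (circlepath 0 r2)" for n :: nat
      unfolding c_def by (intro has_contour_integral_rmul has_contour_integral_laurent_coeff[OF holo]) (use r in auto)
    have eq: "f z * z powi (-int n-1) * w ^ n = f z / z * (w / z) ^ n" if "z \<noteq> 0" for z n
      using that by (simp add: power_int_diff power_int_minus field_simps)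
    have 2: "norm (f z * z powi (-int n-1) * w ^ n) \<le> B2 / r2 * (norm w / r2) ^ n"
      if "norm z = r2" for n :: nat and z
    proof -
      have "z \<noteq> 0" using that r by auto
      with B2[OF that] that r show ?thesis
        by (simp add: eq norm_mult norm_divide norm_power divide_right_mono mult_right_mono)
    qed
    have 3: "(\<lambda>n. B2 / r2 * (norm w / r2) ^ n) summable_on UNIV"
      by (intro summable_on_cmult_right geo') (use r in auto)
    have 4: "((\<lambda>n. f z * z powi (-int n-1) * w ^ n) has_sum f z / (z - w)) UNIV"
      if "norm z = r2" for z
    proof -
      have z: "z \<noteq> 0" "z \<noteq> w" using that r by auto
      have "((\<lambda>n. f z / z * (w / z) ^ n) has_sum f z / z * (1 / (1 - w / z))) UNIV"
        by (intro has_sum_cmult_right geo) (use that r in \<open>simp add: norm_divide\<close>)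
      moreover have "f z / z * (1 / (1 - w / z)) = f z / (z - w)"
        using z by (simp add: field_simps)
      ultimately show ?thesis by (simp only: eq[OF z(1)])
    qed
    show "(\<lambda>z. f z / (z - w)) contour_integrable_on circlepath 0 r2"
      by (rule has_sum_contour_integral_circlepath(1)[OF _ 1 2 3 4]) (use r in auto)
    show "((\<lambda>n. c * fun_laurent_coeff f (int n) * w ^ n) has_sum
      contour_integral (circlepath 0 r2) (\<lambda>z. f z / (z - w))) UNIV"
      by (rule has_sum_contour_integral_circlepath(2)[OF _ 1 2 3 4]) (use r in auto)
  qed
  have inner_int: "(\<lambda>z. f z / (w - z)) contour_integrable_on circlepath 0 r1"
    and inner: "((\<lambda>n. c * fun_laurent_coeff f (-1 - int n) * w powi (-1 - int n)) has_sum
      contour_integral (circlepath 0 r1) (\<lambda>z. f z / (w - z))) UNIV"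
  proof -
    have 1: "((\<lambda>z. f z * z powi (-(-1 - int n)-1) * w powi (-1 - int n)) has_contour_integral
        c * fun_laurent_coeff f (-1 - int n) * w powi (-1 - int n)) (circlepath 0 r1)" for n :: nat
      unfolding c_def by (intro has_contour_integral_rmul has_contour_integral_laurent_coeff[OF holo]) (use r in auto)
    have eq: "f z * z powi (-(-1 - int n)-1) * w powi (-1 - int n) = f z / w * (z / w) ^ n" for z n
      using w by (simp add: power_int_diff power_int_minus field_simps)
    have 2: "norm (f z * z powi (-(-1 - int n)-1) * w powi (-1 - int n)) \<le> B1 / norm w * (r1 / norm w) ^ n"
      if "norm z = r1" for n :: nat and z
      using B1[OF that] that r unfolding eq
      by (simp add: norm_mult norm_divide norm_power divide_right_mono mult_right_mono)
    have 3: "(\<lambda>n. B1 / norm w * (r1 / norm w) ^ n) summable_on UNIV"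
      by (intro summable_on_cmult_right geo') (use r w in \<open>auto simp: divide_less_eq_1\<close>)
    have 4: "((\<lambda>n. f z * z powi (-(-1 - int n)-1) * w powi (-1 - int n)) has_sum f z / (w - z)) UNIV"
      if "norm z = r1" for z
    proof -
      have z: "z \<noteq> w" using that r by auto
      have "((\<lambda>n. f z / w * (z / w) ^ n) has_sum f z / w * (1 / (1 - z / w))) UNIV"
        by (intro has_sum_cmult_right geo) (use that r w in \<open>simp add: norm_divide divide_less_eq_1\<close>)
      moreover have "f z / w * (1 / (1 - z / w)) = f z / (w - z)"
        using z w by (simp add: field_simps)
      ultimately show ?thesis by (simp only: eq)
    qed
    show "(\<lambda>z. f z / (w - z)) contour_integrable_on circlepath 0 r1"
      by (rule has_sum_contour_integral_circlepath(1)[OF _ 1 2 3 4]) (use r in auto)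
    show "((\<lambda>n. c * fun_laurent_coeff f (-1 - int n) * w powi (-1 - int n)) has_sum
      contour_integral (circlepath 0 r1) (\<lambda>z. f z / (w - z))) UNIV"
      by (rule has_sum_contour_integral_circlepath(2)[OF _ 1 2 3 4]) (use r in auto)
  qed
  \<comment> \<open>The difference quotient of \<open>f\<close> at \<open>w\<close> extends holomorphically over \<open>w\<close>; so its integral is the same over both circles.\<close>
  have cauchy: "contour_integral (circlepath 0 r2) (\<lambda>z. f z / (z - w)) +
      contour_integral (circlepath 0 r1) (\<lambda>z. f z / (w - z)) = c * f w"
  proof -
    define g where "g = (\<lambda>z. if z = w then deriv f w else (f z - f w) / (z - w))"
    have "g holomorphic_on ball 0 R - {0}"
      unfolding g_def by (rule pole_lemma_open[OF holo]) auto
    then have eq: "contour_integral (circlepath 0 r2) g = contour_integral (circlepath 0 r1) g"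
      by (rule contour_integral_circlepath_eq(3)[of "ball 0 R", rotated]) (use r in auto)
    have k2: "((\<lambda>z. f w / (z - w)) has_contour_integral c * f w) (circlepath 0 r2)"
      unfolding c_def
      using Cauchy_integral_circlepath_simple[of "\<lambda>_. f w" 0 r2 w] r by (simp add: holomorphic_intros)
    have k1: "((\<lambda>z. f w / (w - z)) has_contour_integral 0) (circlepath 0 r1)"
      by (rule Cauchy_theorem_convex_simple[of _ "ball 0 (norm w)"])
         (use r in \<open>auto intro!: holomorphic_intros\<close>)
    have g2: "contour_integral (circlepath 0 r2) g =
        contour_integral (circlepath 0 r2) (\<lambda>z. f z / (z - w)) - c * f w"
    proof (rule contour_integral_unique)
      have "((\<lambda>z. f z / (z - w) - f w / (z - w)) has_contour_integral
          contour_integral (circlepath 0 r2) (\<lambda>z. f z / (z - w)) - c * f w) (circlepath 0 r2)"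
        by (intro has_contour_integral_diff k2 has_contour_integral_integral outer_int)
      then show "(g has_contour_integral
          contour_integral (circlepath 0 r2) (\<lambda>z. f z / (z - w)) - c * f w) (circlepath 0 r2)"
        by (rule has_contour_integral_eq) (use r in \<open>auto simp: g_def diff_divide_distrib\<close>)
    qed
    have g1: "contour_integral (circlepath 0 r1) g =
        - contour_integral (circlepath 0 r1) (\<lambda>z. f z / (w - z))"
    proof (rule contour_integral_unique)
      have "((\<lambda>z. - (f z / (w - z) - f w / (w - z))) has_contour_integral
          - (contour_integral (circlepath 0 r1) (\<lambda>z. f z / (w - z)) - 0)) (circlepath 0 r1)"
        by (intro has_contour_integral_neg has_contour_integral_diff k1 has_contour_integral_integral inner_int)
      then have "((\<lambda>z. - (f z / (w - z) - f w / (w - z))) has_contour_integral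
          - (contour_integral (circlepath 0 r1) (\<lambda>z. f z / (w - z)))) (circlepath 0 r1)" by simp
      then show "(g has_contour_integral
          - contour_integral (circlepath 0 r1) (\<lambda>z. f z / (w - z))) (circlepath 0 r1)"
      proof (rule has_contour_integral_eq)
        fix z assume "z \<in> path_image (circlepath 0 r1)"
        then have "z \<noteq> w" using r by auto
        then show "- (f z / (w - z) - f w / (w - z)) = g z"
          by (simp add: g_def minus_divide_right flip: diff_divide_distrib)
      qed
    qed
    from eq g1 g2 show ?thesis by (simp add: algebra_simps)
  qed
  have nonneg: "((\<lambda>n. c * (fun_laurent_coeff f n * w powi n)) has_sum
      contour_integral (circlepath 0 r2) (\<lambda>z. f z / (z - w))) {0..}"
  proof -
    have "bij_betw int UNIV {0..}"
      by (rule bij_betwI[where g = nat]) auto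
    from has_sum_reindex_bij_betw[OF this, of "\<lambda>n. c * (fun_laurent_coeff f n * w powi n)"] outer
    show ?thesis by (simp add: mult.assoc)
  qed
  have neg: "((\<lambda>n. c * (fun_laurent_coeff f n * w powi n)) has_sum
      contour_integral (circlepath 0 r1) (\<lambda>z. f z / (w - z))) {..<0}"
  proof -
    have "bij_betw (\<lambda>n. - 1 - int n) UNIV {..<0}"
      by (rule bij_betwI[where g = "\<lambda>m. nat (- 1 - m)"]) auto
    from has_sum_reindex_bij_betw[OF this, of "\<lambda>n. c * (fun_laurent_coeff f n * w powi n)"] inner
    show ?thesis by (simp add: mult.assoc)
  qed
  have "((\<lambda>n. c * (fun_laurent_coeff f n * w powi n)) has_sum c * f w) ({0..} \<union> {..<0})"
    unfolding cauchy[symmetric] by (rule has_sum_Un_disjoint[OF nonneg neg]) auto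
  moreover have "{0..} \<union> {..<0::int} = UNIV" by auto
  ultimately have "((\<lambda>n. c * (fun_laurent_coeff f n * w powi n)) has_sum c * f w) UNIV" by simp
  then have "((\<lambda>n. 1 / c * (c * (fun_laurent_coeff f n * w powi n))) has_sum 1 / c * (c * f w)) UNIV"
    by (rule has_sum_cmult_right)
  moreover have "1 / c * (c * x) = x" for x using c by simp
  ultimately show ?thesis by (simp only:)
qed

section \<open>Laurent coefficients of germs\<close>

definition laurent_series :: "(complex \<Rightarrow> complex) \<Rightarrow> (int \<Rightarrow> complex) \<Rightarrow> bool" where
  "laurent_series f a \<longleftrightarrow>
     (\<exists>R>0. \<forall>z. z \<noteq> 0 \<and> norm z < R \<longrightarrow> ((\<lambda>n. a n * z powi n) has_sum f z) UNIV)"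

lemma laurent_series_fun_laurent_coeff:
  assumes "isolated_singularity_at f 0"
  shows "laurent_series f (fun_laurent_coeff f)"
proof -
  obtain R where "R > 0" "f analytic_on ball 0 R - {0}"
    using assms by (auto simp: isolated_singularity_at_def)
  then show ?thesis
    using laurent_expansion[of f R] analytic_imp_holomorphic unfolding laurent_series_def by blast
qed

lemma
  assumes "laurent_series f a"
  shows laurent_series_imp_isolated_singularity: "isolated_singularity_at f 0"
    and fun_laurent_coeff_eqI: "fun_laurent_coeff f = a"
proof -
  obtain R where R: "R > 0" and hs: "\<And>z. z \<noteq> 0 \<Longrightarrow> norm z < R \<Longrightarrow> ((\<lambda>n. a n * z powi n) has_sum f z) UNIV"
    using assms by (auto simp: laurent_series_def)
  note * = laurent_series_unique[OF hs R]
  show "isolated_singularity_at f 0"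
    unfolding isolated_singularity_at_def
    using *(1) R by (intro exI[of _ R]) (auto simp: analytic_on_open open_Diff)
  show "fun_laurent_coeff f = a" using *(2) by auto
qed

lemma laurent_series_cong:
  assumes "laurent_series f a" "laurent_series g a"
  shows "\<forall>\<^sub>F z in at 0. f z = g z"
proof -
  obtain R S where "R > 0" "S > 0"
    and f: "\<And>z. z \<noteq> 0 \<Longrightarrow> norm z < R \<Longrightarrow> ((\<lambda>n. a n * z powi n) has_sum f z) UNIV"
    and g: "\<And>z. z \<noteq> 0 \<Longrightarrow> norm z < S \<Longrightarrow> ((\<lambda>n. a n * z powi n) has_sum g z) UNIV"
    using assms by (auto simp: laurent_series_def)
  then show ?thesis
    unfolding eventually_at
    by (intro exI[of _ "min R S"]) (auto intro: has_sum_unique)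
qed

lemma laurent_series_add:
  assumes "laurent_series f a" "laurent_series g b"
  shows "laurent_series (\<lambda>z. f z + g z) (\<lambda>n. a n + b n)"
proof -
  obtain R S where RS: "R > 0" "S > 0"
    and f: "\<And>z. z \<noteq> 0 \<Longrightarrow> norm z < R \<Longrightarrow> ((\<lambda>n. a n * z powi n) has_sum f z) UNIV"
    and g: "\<And>z. z \<noteq> 0 \<Longrightarrow> norm z < S \<Longrightarrow> ((\<lambda>n. b n * z powi n) has_sum g z) UNIV"
    using assms by (auto simp: laurent_series_def)
  have "((\<lambda>n. (a n + b n) * z powi n) has_sum f z + g z) UNIV" if "z \<noteq> 0" "norm z < min R S" for z
    using has_sum_add[OF f g, of z z] that by (simp add: distrib_right)
  with RS show ?thesis unfolding laurent_series_def by (intro exI[of _ "min R S"]) auto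
qed

lemma laurent_series_cmult:
  assumes "laurent_series f a"
  shows "laurent_series (\<lambda>z. c * f z) (\<lambda>n. c * a n)"
proof -
  obtain R where R: "R > 0"
    and f: "\<And>z. z \<noteq> 0 \<Longrightarrow> norm z < R \<Longrightarrow> ((\<lambda>n. a n * z powi n) has_sum f z) UNIV"
    using assms by (auto simp: laurent_series_def)
  have "((\<lambda>n. c * a n * z powi n) has_sum c * f z) UNIV" if "z \<noteq> 0" "norm z < R" for z
    using has_sum_cmult_right[OF f, of z c] that by (simp add: mult.assoc)
  with R show ?thesis unfolding laurent_series_def by (intro exI[of _ R]) auto
qed

lemma laurent_series_powi_mult:
  assumes "laurent_series f a"
  shows "laurent_series (\<lambda>z. z powi m * f z) (\<lambda>n. a (n - m))"
proof -
  obtain R where R: "R > 0"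
    and f: "\<And>z. z \<noteq> 0 \<Longrightarrow> norm z < R \<Longrightarrow> ((\<lambda>n. a n * z powi n) has_sum f z) UNIV"
    using assms by (auto simp: laurent_series_def)
  have "((\<lambda>n. a (n - m) * z powi n) has_sum z powi m * f z) UNIV" if z: "z \<noteq> 0" "norm z < R" for z
  proof -
    have bij: "bij_betw (\<lambda>n. n - m) UNIV UNIV"
      by (rule bij_betwI[where g = "\<lambda>n. n + m"]) auto
    have "((\<lambda>n. z powi m * (a n * z powi n)) has_sum z powi m * f z) UNIV"
      using has_sum_cmult_right[OF f, of z] z by blast
    then have "((\<lambda>n. z powi m * (a (n - m) * z powi (n - m))) has_sum z powi m * f z) UNIV"
      by (subst has_sum_reindex_bij_betw[OF bij, of "\<lambda>n. z powi m * (a n * z powi n)"])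
    moreover have "z powi m * (a (n - m) * z powi (n - m)) = a (n - m) * z powi n" for n
      using z by (simp add: power_int_diff)
    ultimately show ?thesis by (simp only:)
  qed
  with R show ?thesis unfolding laurent_series_def by (intro exI[of _ R]) auto
qed

lemma laurent_series_scale:
  assumes "laurent_series f a" and q: "q \<noteq> 0"
  shows "laurent_series (\<lambda>z. f (q * z)) (\<lambda>n. q powi n * a n)"
proof -
  obtain R where R: "R > 0"
    and f: "\<And>z. z \<noteq> 0 \<Longrightarrow> norm z < R \<Longrightarrow> ((\<lambda>n. a n * z powi n) has_sum f z) UNIV"
    using assms by (auto simp: laurent_series_def)
  have "((\<lambda>n. q powi n * a n * z powi n) has_sum f (q * z)) UNIV"
    if "z \<noteq> 0" "norm z < R / norm q" for z
    using f[of "q * z"] that q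
    by (simp add: norm_mult field_simps power_int_mult_distrib)
  with R q show ?thesis unfolding laurent_series_def by (intro exI[of _ "R / norm q"]) auto
qed

lemma laurent_series_const: "laurent_series (\<lambda>_. c) (\<lambda>n. if n = 0 then c else 0)"
  unfolding laurent_series_def
proof (intro exI[of _ 1] conjI allI impI)
  fix z :: complex
  show "((\<lambda>n. (if n = 0 then c else 0) * z powi n) has_sum c) UNIV"
    using has_sum_finite_neutralI[of "{0}" UNIV "\<lambda>n. (if n = 0 then c else 0) * z powi n"] by simp
qed simp

text \<open>
  For large \<open>n\<close> the condition asks for geometric growth of rate at most \<open>1 / R\<close>, up to arbitrarily small
  losses; for \<open>n \<rightarrow> -\<infinity>\<close> it becomes stronger as \<open>\<rho>\<close> decreases and forces decay faster
  than any geometric sequence.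
\<close>

definition laurent_bounded :: "(int \<Rightarrow> complex) \<Rightarrow> real \<Rightarrow> bool" where
  "laurent_bounded a R \<longleftrightarrow> (\<forall>\<rho>. 0 < \<rho> \<and> \<rho> < R \<longrightarrow> (\<exists>C. \<forall>n. norm (a n) \<le> C * \<rho> powi (-n)))"

lemma laurent_series_bounded:
  assumes "laurent_series f a"
  shows "\<exists>R>0. laurent_bounded a R"
proof -
  obtain R where R: "R > 0"
    and f: "\<And>z. z \<noteq> 0 \<Longrightarrow> norm z < R \<Longrightarrow> ((\<lambda>n. a n * z powi n) has_sum f z) UNIV"
    using assms by (auto simp: laurent_series_def)
  have "\<exists>C. \<forall>n. norm (a n) \<le> C * \<rho> powi (-n)" if \<rho>: "0 < \<rho>" "\<rho> < R" for \<rho>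
  proof -
    have sm: "(\<lambda>n. norm (a n) * \<rho> powi n) summable_on UNIV"
      by (rule laurent_series_norm_summable[OF f \<rho>]) auto
    have "norm (a n) \<le> (\<Sum>\<^sub>\<infinity>n. norm (a n) * \<rho> powi n) * \<rho> powi (-n)" for n
    proof -
      have "(\<Sum>n\<in>{n}. norm (a n) * \<rho> powi n) \<le> (\<Sum>\<^sub>\<infinity>n. norm (a n) * \<rho> powi n)"
        by (rule finite_sum_le_infsum[OF sm]) (use \<rho> in auto)
      then show ?thesis using \<rho> by (simp add: power_int_minus field_simps)
    qed
    then show ?thesis by blast
  qed
  with R show ?thesis unfolding laurent_bounded_def by blast
qed

text \<open>
  At a point \<open>z\<close>, the bounds for the radii \<open>t |z|\<close> and \<open>|z| / t\<close> with some \<open>t < 1\<close> make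
  the terms of the series decay like \<open>t\<^bsup>|n|\<^esup>\<close> in both directions.
\<close>

lemma laurent_bounded_imp_series:
  assumes a: "laurent_bounded a R" and R: "R > 0"
  shows "\<exists>f. laurent_series f a"
proof -
  have "(\<lambda>n. a n * z powi n) summable_on UNIV" if z: "z \<noteq> 0" "norm z < R" for z
  proof -
    \<comment> \<open>Any \<open>t\<close> strictly between \<open>|z| / R\<close> and \<open>1\<close> would do: it keeps both radii \<open>t |z|\<close> and \<open>|z| / t\<close> below \<open>R\<close>.\<close>
    define t where "t = (1 + norm z / R) / 2"
    have "norm z / R < 1" "norm z / R > 0" using z R by (auto simp: field_simps)
    moreover have "0 < (1 + x) / 2 \<and> (1 + x) / 2 < 1 \<and> x < (1 + x) / 2" if "x < 1" "x > 0" for x :: real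
      using that by auto
    ultimately have t: "0 < t" "t < 1" "norm z / R < t" unfolding t_def by blast+
    have "norm z * t < norm z"
      using mult_strict_left_mono[of t 1 "norm z"] t z by simp
    then have 1: "norm z * t < R" using z(2) by linarith
    have 1: "norm z * t < R" "0 < norm z * t" using 1 t z by auto
    have 2: "norm z / t < R" "0 < norm z / t" using t z R by (auto simp: field_simps)
    obtain C1 where C1: "norm (a n) \<le> C1 * (norm z * t) powi (-n)" for n
      using a 1 unfolding laurent_bounded_def by blast
    obtain C2 where C2: "norm (a n) \<le> C2 * (norm z / t) powi (-n)" for n
      using a 2 unfolding laurent_bounded_def by blast
    define C where "C = max (max C1 C2) 0"
    have bnd: "norm (a n * z powi n) \<le> C * t ^ nat \<bar>n\<bar>" for n
    proof (cases "n \<ge> 0")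
      case True
      have "norm (a n * z powi n) \<le> C2 * (norm z / t) powi (-n) * norm z powi n"
        unfolding norm_mult norm_power_int by (intro mult_right_mono C2) auto
      also have "\<dots> = C2 * t powi n"
        using z t by (simp add: power_int_minus power_int_divide_distrib)
      also have "t powi n = t ^ nat \<bar>n\<bar>"
        using True by (simp add: power_int_def)
      also have "C2 * t ^ nat \<bar>n\<bar> \<le> C * t ^ nat \<bar>n\<bar>"
        using t by (intro mult_right_mono) (auto simp: C_def)
      finally show ?thesis .
    next
      case False
      have "norm (a n * z powi n) \<le> C1 * (norm z * t) powi (-n) * norm z powi n"
        unfolding norm_mult norm_power_int by (intro mult_right_mono C1) auto
      also have "\<dots> = C1 * t powi (-n)"
        using z t by (simp add: power_int_minus power_int_mult_distrib)
      also have "t powi (-n) = t ^ nat \<bar>n\<bar>"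
        using False by (simp add: power_int_def)
      also have "C1 * t ^ nat \<bar>n\<bar> \<le> C * t ^ nat \<bar>n\<bar>"
        using t by (intro mult_right_mono) (auto simp: C_def)
      finally show ?thesis .
    qed
    have geo: "(\<lambda>n::nat. t ^ n) summable_on UNIV"
      by (rule norm_summable_imp_summable_on) (use t in \<open>auto intro!: summable_geometric\<close>)
    have "bij_betw int UNIV {0..}" "bij_betw (\<lambda>n. - 1 - int n) UNIV {..<0}"
      by (rule bij_betwI[where g = nat]; force)
         (rule bij_betwI[where g = "\<lambda>m. nat (- 1 - m)"]; force)
    note reindex = this[THEN summable_on_reindex_bij_betw, of "\<lambda>n. t ^ nat \<bar>n\<bar>"]
    have "(\<lambda>n::int. t ^ nat \<bar>n\<bar>) summable_on {0..}"
      using reindex(1) geo by simp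
    moreover have "(\<lambda>n::int. t ^ nat \<bar>n\<bar>) summable_on {..<0}"
    proof -
      have "nat \<bar>- 1 - int n\<bar> = Suc n" for n by simp
      then show ?thesis
        using reindex(2) summable_on_cmult_right[OF geo, of t] by simp
    qed
    ultimately have "(\<lambda>n::int. t ^ nat \<bar>n\<bar>) summable_on ({0..} \<union> {..<0})"
      by (rule summable_on_Un_disjoint) auto
    moreover have "{0..} \<union> {..<0::int} = UNIV" by auto
    ultimately have "(\<lambda>n::int. t ^ nat \<bar>n\<bar>) summable_on UNIV" by simp
    then have "(\<lambda>n::int. C * t ^ nat \<bar>n\<bar>) summable_on UNIV"
      by (rule summable_on_cmult_right)
    then have "(\<lambda>n. norm (a n * z powi n)) summable_on UNIV"
      by (rule Infinite_Sum.abs_summable_on_comparison_test') (rule bnd)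
    then show ?thesis by (simp add: summable_on_iff_abs_summable_on_complex)
  qed
  then have "laurent_series (\<lambda>z. \<Sum>\<^sub>\<infinity>n. a n * z powi n) a"
    unfolding laurent_series_def using R by (intro exI[of _ R]) auto
  then show ?thesis by blast
qed

lift_definition laurent_coeff :: "germ \<Rightarrow> int \<Rightarrow> complex" is fun_laurent_coeff
  by (auto simp: germ_rel_def fun_laurent_coeff_def intro!: ext residue_cong elim!: eventually_mono)

lemma germ_eqI:
  assumes "\<And>n. laurent_coeff f n = laurent_coeff g n"
  shows "f = g"
proof -
  from assms have "laurent_coeff f = laurent_coeff g" by auto
  then show ?thesis
    by transfer (metis germ_rel_def laurent_series_cong laurent_series_fun_laurent_coeff)
qed

lemma laurent_coeff_add: "laurent_coeff (f + g) n = laurent_coeff f n + laurent_coeff g n"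
  by transfer
     (auto simp: germ_rel_def dest!: laurent_series_fun_laurent_coeff dest: fun_laurent_coeff_eqI[OF laurent_series_add])

lemma laurent_coeff_const_mult: "laurent_coeff (germ_const c * f) n = c * laurent_coeff f n"
  by transfer
     (simp add: germ_rel_def fun_cong[OF fun_laurent_coeff_eqI[OF laurent_series_cmult[OF laurent_series_fun_laurent_coeff]]])

lemma laurent_coeff_zpow_mult: "laurent_coeff (germ_zpow m * f) n = laurent_coeff f (n - m)"
  by transfer
     (simp add: germ_rel_def fun_cong[OF fun_laurent_coeff_eqI[OF laurent_series_powi_mult[OF laurent_series_fun_laurent_coeff]]])

lemma laurent_coeff_sigma:
  assumes "q \<noteq> 0"
  shows "laurent_coeff (sigma q f) n = q powi n * laurent_coeff f n"
  using assms
  by transfer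
     (simp add: germ_rel_def fun_cong[OF fun_laurent_coeff_eqI[OF laurent_series_scale[OF laurent_series_fun_laurent_coeff]]])

lemma laurent_coeff_const: "laurent_coeff (germ_const c) n = (if n = 0 then c else 0)"
  by transfer (simp add: fun_laurent_coeff_eqI[OF laurent_series_const])

lemma laurent_coeff_bounded: "\<exists>R>0. laurent_bounded (laurent_coeff f) R"
  by transfer (auto simp: germ_rel_def dest!: laurent_series_fun_laurent_coeff laurent_series_bounded)

lemma laurent_coeff_surj:
  assumes "laurent_bounded a R" "R > 0"
  shows "\<exists>f. laurent_coeff f = a"
proof -
  from assms obtain g where g: "laurent_series g a" using laurent_bounded_imp_series by blast
  then have "germ_rel g g" by (simp add: germ_rel_def laurent_series_imp_isolated_singularity)
  then have "laurent_coeff (abs_germ g) = a"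
    by (simp add: laurent_coeff.abs_eq fun_laurent_coeff_eqI[OF g])
  then show ?thesis by blast
qed

lemma laurent_coeff_0 [simp]: "laurent_coeff 0 n = 0"
  using laurent_coeff_add[of 0 0 n] by simp

lemma laurent_coeff_sum: "laurent_coeff (\<Sum>i\<in>I. f i) n = (\<Sum>i\<in>I. laurent_coeff (f i) n)"
  by (induction I rule: infinite_finite_induct) (auto simp: laurent_coeff_add)

section \<open>Damped recurrences on a half-line\<close>

definition exp_bounded :: "'i set \<Rightarrow> real \<Rightarrow> (nat \<Rightarrow> 'i \<Rightarrow> complex) \<Rightarrow> bool" where
  "exp_bounded I R x \<longleftrightarrow> (\<exists>C. \<forall>p. \<forall>i\<in>I. norm (x p i) \<le> C * R ^ p)"

text \<open>
  The operator that looks \<open>d\<close> steps ahead, applies the fixed matrix \<open>T\<close>, and multiplies the \<open>p\<close>-th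
  entry by \<open>\<kappa>\<^sup>p\<close>. The vectors are indexed by an arbitrary finite set, later the positions in a matrix.
\<close>

definition damped_shift ::
    "'i set \<Rightarrow> nat \<Rightarrow> complex \<Rightarrow> ('i \<Rightarrow> 'i \<Rightarrow> complex) \<Rightarrow> (nat \<Rightarrow> 'i \<Rightarrow> complex) \<Rightarrow> nat \<Rightarrow> 'i \<Rightarrow> complex" where
  "damped_shift I d \<kappa> T x p i = \<kappa> ^ p * (\<Sum>j\<in>I. T i j * x (p + d) j)"

text \<open>
  After \<open>j\<close> applications the shift is \<open>j d \<ge> j\<close>, so that the next one contributes a damping factor of norm
  at most \<open>|\<kappa>|\<^sup>j\<close>. In total, \<open>j\<close> applications multiply a bound \<open>C R\<^sup>p\<close> by at most \<open>D\<^sup>j |\<kappa>|\<^bsup>0+1+\<dots>+(j-1)\<^esup>\<close> with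
  \<open>D = K R\<^sup>d\<close>. This is summable in \<open>j\<close>, whatever \<open>D\<close> is.

  The hypothesis is stated for a sequence \<open>t\<close> of iterates rather than for powers of the operator; thus a
  fixed point can be taken as a constant sequence.
\<close>

lemma damped_shift_iterates_bound:
  fixes t :: "nat \<Rightarrow> nat \<Rightarrow> 'i \<Rightarrow> complex"
  assumes I: "finite I" and d: "d \<ge> 1" and \<kappa>: "norm \<kappa> < 1" and R: "R > 0"
    and t0: "exp_bounded I R (t 0)"
    and step: "\<And>j p i. i \<in> I \<Longrightarrow> t (Suc j) p i = damped_shift I d \<kappa> T (t j) p i"
  shows "\<exists>C b. summable b \<and> (\<forall>j p. \<forall>i\<in>I. norm (t j p i) \<le> C * R ^ p * b j)"
proof -
  obtain C where C: "norm (t 0 p i) \<le> C * R ^ p" if "i \<in> I" for p i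
    using t0 unfolding exp_bounded_def by blast
  define C' where "C' = max C 0"
  have C'nn: "C' \<ge> 0" by (simp add: C'_def)
  have C0: "norm (t 0 p i) \<le> C' * R ^ p" if "i \<in> I" for p i
  proof -
    have "C * R ^ p \<le> C' * R ^ p" using R by (intro mult_right_mono) (auto simp: C'_def)
    with C[OF that, of p] show ?thesis by linarith
  qed
  define K where "K = (\<Sum>i\<in>I. \<Sum>j\<in>I. norm (T i j))"
  have K: "K \<ge> 0" unfolding K_def by (intro sum_nonneg) auto
  have Kb: "(\<Sum>j\<in>I. norm (T i j)) \<le> K" if "i \<in> I" for i
    unfolding K_def using that I
    by (intro member_le_sum[of i I "\<lambda>i. \<Sum>j\<in>I. norm (T i j)"]) (auto intro: sum_nonneg)
  define D where "D = K * R ^ d"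
  have D: "D \<ge> 0" using K R by (simp add: D_def)
  define k where "k = norm \<kappa>"
  have k: "0 \<le> k" "k < 1" using \<kappa> by (auto simp: k_def)
  have main: "norm (t j p i) \<le> C' * R ^ p * D ^ j * k ^ (\<Sum>l<j. p + l)" if "i \<in> I" for i j p
    using that
  proof (induction j arbitrary: p i)
    case 0
    then show ?case using C0 by simp
  next
    case (Suc j)
    let ?B = "C' * R ^ (p + d) * D ^ j * k ^ (\<Sum>l<j. p + d + l)"
    have B: "?B \<ge> 0" using C'nn R D k by simp
    have "norm (t (Suc j) p i) \<le> k ^ p * (\<Sum>l\<in>I. norm (T i l) * norm (t j (p + d) l))"
      unfolding step[OF Suc.prems] damped_shift_def norm_mult norm_power k_def
      by (intro mult_left_mono order_trans[OF norm_sum]) (auto simp: norm_mult)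
    also have "\<dots> \<le> k ^ p * (\<Sum>l\<in>I. norm (T i l) * ?B)"
      using k Suc.IH[of _ "p + d"] by (intro mult_left_mono sum_mono) auto
    also have "\<dots> = k ^ p * ((\<Sum>l\<in>I. norm (T i l)) * ?B)"
      by (simp add: sum_distrib_right)
    also have "\<dots> \<le> k ^ p * (K * ?B)"
      using k B Kb[OF Suc.prems] by (intro mult_left_mono mult_right_mono) auto
    also have "\<dots> = C' * R ^ p * D ^ Suc j * k ^ (p + (\<Sum>l<j. p + d + l))"
      by (simp add: D_def power_add mult_ac)
    also have "\<dots> \<le> C' * R ^ p * D ^ Suc j * k ^ (\<Sum>l<Suc j. p + l)"
    proof (intro mult_left_mono power_decreasing)
      have "(\<Sum>l<Suc j. p + l) = p + (\<Sum>l<j. p + Suc l)"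
        by (subst sum.lessThan_Suc_shift) simp
      also have "\<dots> \<le> p + (\<Sum>l<j. p + d + l)"
        using d by (intro add_left_mono sum_mono) auto
      finally show "(\<Sum>l<Suc j. p + l) \<le> p + (\<Sum>l<j. p + d + l)" .
    qed (use C'nn R D k in auto)
    finally show ?case .
  qed
  define b where "b = (\<lambda>j. D ^ j * k ^ (\<Sum>l<j. l))"
  have "norm (t j p i) \<le> C' * R ^ p * b j" if "i \<in> I" for i j p
  proof -
    have "norm (t j p i) \<le> C' * R ^ p * D ^ j * k ^ (\<Sum>l<j. p + l)" by (rule main[OF that])
    also have "\<dots> \<le> C' * R ^ p * D ^ j * k ^ (\<Sum>l<j. l)"
      using C'nn R D k by (intro mult_left_mono power_decreasing sum_mono) auto
    finally show ?thesis by (simp add: b_def mult.assoc)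
  qed
  moreover have "summable b"
  proof -
    have "(\<lambda>j. D * k ^ j) \<longlonglongrightarrow> D * 0"
      using k by (intro tendsto_intros LIMSEQ_power_zero) auto
    then have "\<forall>\<^sub>F j in sequentially. D * k ^ j < 1 / 2"
      by (rule order_tendstoD) auto
    then obtain N where N: "D * k ^ j < 1 / 2" if "j \<ge> N" for j
      unfolding eventually_sequentially by auto
    show ?thesis
    proof (rule summable_ratio_test[of "1/2" N])
      fix j assume j: "j \<ge> N"
      have "b (Suc j) = (D * k ^ j) * b j"
        by (simp add: b_def power_add mult_ac)
      moreover have "b j \<ge> 0" using D k by (simp add: b_def)
      moreover have "(D * k ^ j) * b j \<le> 1 / 2 * b j"
        by (rule mult_right_mono) (use N[OF j] \<open>b j \<ge> 0\<close> in auto)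
      moreover have "b (Suc j) \<ge> 0" using D k by (simp add: b_def)
      ultimately show "norm (b (Suc j)) \<le> 1 / 2 * norm (b j)" by simp
    qed simp
  qed
  ultimately show ?thesis by blast
qed

text \<open>
  A fixed point equals all its iterates, and these tend to \<open>0\<close>.
\<close>

lemma damped_shift_fixed_point_eq_0:
  assumes I: "finite I" and d: "d \<ge> 1" and \<kappa>: "norm \<kappa> < 1" and R: "R > 0"
    and x: "exp_bounded I R x"
    and fixp: "\<And>p i. i \<in> I \<Longrightarrow> x p i = damped_shift I d \<kappa> T x p i"
    and i: "i \<in> I"
  shows "x p i = 0"
proof -
  from damped_shift_iterates_bound[OF I d \<kappa> R, of "\<lambda>_. x", OF x fixp]
  have "\<exists>C b. summable b \<and> (\<forall>(j::nat) p. \<forall>i\<in>I. norm (x p i) \<le> C * R ^ p * b j)"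
    by simp
  then obtain C b where b: "summable b"
    and "\<forall>(j::nat) p. \<forall>i\<in>I. norm (x p i) \<le> C * R ^ p * b j" by (elim exE conjE)
  with i have le: "norm (x p i) \<le> C * R ^ p * b j" for j by blast
  have "(\<lambda>j. C * R ^ p * b j) \<longlonglongrightarrow> C * R ^ p * 0"
    by (intro tendsto_intros summable_LIMSEQ_zero b)
  then have "norm (x p i) \<le> C * R ^ p * 0"
    by (rule LIMSEQ_le_const) (use le in auto)
  then show ?thesis by simp
qed

text \<open>
  The solution is the Neumann series of the operator applied to \<open>u\<close>. It does not depend on the
  growth rate, so it inherits all geometric bounds of \<open>u\<close> simultaneously. This matters for negative
  Laurent exponents, where bounds for all small rates are required of one and the same sequence.
\<close>

lemma damped_shift_solution:
  assumes I: "finite I" and d: "d \<ge> 1" and \<kappa>: "norm \<kappa> < 1" and R: "R > 0"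
    and u: "exp_bounded I R u"
  shows "\<exists>x. (\<forall>p. \<forall>i\<in>I. x p i = u p i + damped_shift I d \<kappa> T x p i) \<and>
             (\<forall>S>0. exp_bounded I S u \<longrightarrow> exp_bounded I S x)"
proof -
  define t where "t = (\<lambda>j. (damped_shift I d \<kappa> T ^^ j) u)"
  have t0: "t 0 = u" and tS: "t (Suc j) p i = damped_shift I d \<kappa> T (t j) p i" for j p i
    by (simp_all add: t_def)
  note bound = damped_shift_iterates_bound[OF I d \<kappa>, of _ t T, unfolded t0, OF _ _ tS]
  have summ: "summable (\<lambda>j. t j p i)" if "i \<in> I" for p i
  proof -
    from bound[OF R u] obtain C b where b: "summable b"
      and "\<forall>j p. \<forall>i\<in>I. norm (t j p i) \<le> C * R ^ p * b j" by (elim exE conjE)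
    with that have le: "norm (t j p i) \<le> C * R ^ p * b j" for j by blast
    show ?thesis
      by (rule summable_comparison_test'[OF summable_mult[OF b]]) (use le in auto)
  qed
  define x where "x = (\<lambda>p i. \<Sum>j. t j p i)"
  have "x p i = u p i + damped_shift I d \<kappa> T x p i" if i: "i \<in> I" for p i
  proof -
    have "x p i = u p i + (\<Sum>j. t (Suc j) p i)"
      unfolding x_def using suminf_split_head[OF summ[OF i, of p]] by (simp add: t0)
    also have "(\<Sum>j. t (Suc j) p i) = \<kappa> ^ p * (\<Sum>l\<in>I. T i l * x (p + d) l)"
    proof -
      have "(\<lambda>j. \<Sum>l\<in>I. T i l * t j (p + d) l) sums (\<Sum>l\<in>I. T i l * x (p + d) l)"
        unfolding x_def by (intro sums_sum sums_mult summable_sums summ)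
      then have "(\<lambda>j. \<kappa> ^ p * (\<Sum>l\<in>I. T i l * t j (p + d) l)) sums (\<kappa> ^ p * (\<Sum>l\<in>I. T i l * x (p + d) l))"
        by (rule sums_mult)
      then show ?thesis
        by (simp only: tS damped_shift_def sums_iff)
    qed
    finally show ?thesis by (simp add: damped_shift_def)
  qed
  moreover have "exp_bounded I S x" if "S > 0" "exp_bounded I S u" for S
  proof -
    from bound[OF that] obtain C b where b: "summable b"
      and *: "\<forall>j p. \<forall>i\<in>I. norm (t j p i) \<le> C * S ^ p * b j" by (elim exE conjE)
    then have le: "norm (t j p i) \<le> C * S ^ p * b j" if "i \<in> I" for j p i using that by blast
    have "norm (x p i) \<le> C * suminf b * S ^ p" if "i \<in> I" for p i
    proof -
      have "norm (x p i) \<le> (\<Sum>j. C * S ^ p * b j)"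
        unfolding x_def by (rule norm_suminf_le[OF le[OF that] summable_mult[OF b]])
      also have "\<dots> = C * suminf b * S ^ p"
        by (subst suminf_mult[OF b]) (simp add: mult_ac)
      finally show ?thesis .
    qed
    then show ?thesis unfolding exp_bounded_def by (intro exI[of _ "C * suminf b"]) simp
  qed
  ultimately show ?thesis by (intro exI[of _ x] conjI allI ballI impI)
qed

section \<open>Damped recurrences for matrices\<close>

lemma mult_mat_index_sum:
  assumes "A \<in> carrier_mat n k" "B \<in> carrier_mat k m" "i < n" "j < m"
  shows "(A * B) $$ (i, j) = (\<Sum>l<k. A $$ (i, l) * B $$ (l, j))"
  using assms by (simp add: scalar_prod_def lessThan_atLeast0)

lemma mult_mat_index_sum3:
  fixes P :: "'a :: comm_semiring_0 mat"
  assumes "P \<in> carrier_mat n n" "X \<in> carrier_mat n m" "Q \<in> carrier_mat m m" "a < n" "b < m"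
  shows "(P * X * Q) $$ (a, b) =
    (\<Sum>(i, j)\<in>{..<n} \<times> {..<m}. P $$ (a, i) * Q $$ (j, b) * X $$ (i, j))"
proof -
  have PX: "P * X \<in> carrier_mat n m" using assms by auto
  have "(P * X * Q) $$ (a, b) = (\<Sum>j<m. (P * X) $$ (a, j) * Q $$ (j, b))"
    by (rule mult_mat_index_sum[OF PX assms(3,4,5)])
  also have "\<dots> = (\<Sum>j<m. (\<Sum>i<n. P $$ (a, i) * X $$ (i, j)) * Q $$ (j, b))"
    by (intro sum.cong refl arg_cong2[of _ _ _ _ "(*)"] mult_mat_index_sum[OF assms(1,2,4)]) auto
  also have "\<dots> = (\<Sum>j<m. \<Sum>i<n. P $$ (a, i) * Q $$ (j, b) * X $$ (i, j))"
    by (simp add: sum_distrib_left sum_distrib_right mult_ac)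
  also have "\<dots> = (\<Sum>i<n. \<Sum>j<m. P $$ (a, i) * Q $$ (j, b) * X $$ (i, j))"
    by (rule sum.swap)
  finally show ?thesis by (simp add: sum.cartesian_product)
qed

lemma damped_shift_mat:
  assumes "P \<in> carrier_mat n n" "Q \<in> carrier_mat m m" "\<And>p. x p \<in> carrier_mat n m" "a < n" "b < m"
  shows "damped_shift ({..<n} \<times> {..<m}) d \<kappa> (\<lambda>(a, b) (i, j). P $$ (a, i) * Q $$ (j, b))
      (\<lambda>p i. x p $$ i) p (a, b) = (\<kappa> ^ p \<cdot>\<^sub>m (P * x (p + d) * Q)) $$ (a, b)"
proof -
  have "P * x (p + d) * Q \<in> carrier_mat n m" using assms by auto
  then have "(\<kappa> ^ p \<cdot>\<^sub>m (P * x (p + d) * Q)) $$ (a, b) = \<kappa> ^ p * (P * x (p + d) * Q) $$ (a, b)"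
    using assms(4,5) by (intro index_smult_mat(1)) auto
  then show ?thesis
    unfolding mult_mat_index_sum3[OF assms(1) assms(3)[of "p + d"] assms(2,4,5)]
    by (simp add: damped_shift_def case_prod_unfold)
qed

lemma mat_damped_shift_solution:
  assumes P: "P \<in> carrier_mat n n" and Q: "Q \<in> carrier_mat m m" and u: "\<And>p. u p \<in> carrier_mat n m"
    and d: "d \<ge> 1" and \<kappa>: "norm \<kappa> < 1" and R: "R > 0"
    and eb: "exp_bounded ({..<n} \<times> {..<m}) R (\<lambda>p i. u p $$ i)"
  shows "\<exists>x. (\<forall>p. x p \<in> carrier_mat n m) \<and> (\<forall>p. x p = u p + \<kappa> ^ p \<cdot>\<^sub>m (P * x (p + d) * Q)) \<and>
     (\<forall>S>0. exp_bounded ({..<n} \<times> {..<m}) S (\<lambda>p i. u p $$ i) \<longrightarrow>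
            exp_bounded ({..<n} \<times> {..<m}) S (\<lambda>p i. x p $$ i))"
proof -
  let ?I = "{..<n} \<times> {..<m}" and ?T = "\<lambda>(a, b) (i, j). P $$ (a, i) * Q $$ (j, b)"
  have "finite ?I" by simp
  from damped_shift_solution[OF this d \<kappa> R eb, of ?T]
  obtain x where x0: "\<forall>p. \<forall>i\<in>?I. x p i = u p $$ i + damped_shift ?I d \<kappa> ?T x p i"
    and xb0: "\<forall>S>0. exp_bounded ?I S (\<lambda>p i. u p $$ i) \<longrightarrow> exp_bounded ?I S x"
    by (elim exE conjE)
  have x: "x p i = u p $$ i + damped_shift ?I d \<kappa> ?T x p i" if "i \<in> ?I" for p i
    by (rule x0[rule_format, OF that])
  have xb: "exp_bounded ?I S x" if "S > 0" "exp_bounded ?I S (\<lambda>p i. u p $$ i)" for S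
    by (rule xb0[rule_format, OF that])
  define X where "X = (\<lambda>p. mat n m (x p))"
  have X: "X p \<in> carrier_mat n m" for p by (simp add: X_def)
  have Xx: "X p $$ i = x p i" if "i \<in> ?I" for p i using that by (auto simp: X_def)
  have "X p = u p + \<kappa> ^ p \<cdot>\<^sub>m (P * X (p + d) * Q)" for p
  proof (rule eq_matI)
    fix a b assume "a < dim_row (u p + \<kappa> ^ p \<cdot>\<^sub>m (P * X (p + d) * Q))"
      "b < dim_col (u p + \<kappa> ^ p \<cdot>\<^sub>m (P * X (p + d) * Q))"
    then have ab: "a < n" "b < m" using P Q by auto
    have "damped_shift ?I d \<kappa> ?T x p (a, b) = damped_shift ?I d \<kappa> ?T (\<lambda>p i. X p $$ i) p (a, b)"
      unfolding damped_shift_def by (intro arg_cong2[of _ _ _ _ "(*)"] refl sum.cong) (simp add: Xx)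
    also have "\<dots> = (\<kappa> ^ p \<cdot>\<^sub>m (P * X (p + d) * Q)) $$ (a, b)"
      by (rule damped_shift_mat[OF P Q X ab])
    finally have "damped_shift ?I d \<kappa> ?T x p (a, b) = (\<kappa> ^ p \<cdot>\<^sub>m (P * X (p + d) * Q)) $$ (a, b)" .
    then show "X p $$ (a, b) = (u p + \<kappa> ^ p \<cdot>\<^sub>m (P * X (p + d) * Q)) $$ (a, b)"
      using ab x[of "(a, b)" p] Xx[of "(a, b)" p] P Q by simp
  qed (use P Q X in auto)
  moreover have "exp_bounded ?I S (\<lambda>p i. X p $$ i)"
    if "S > 0" "exp_bounded ?I S (\<lambda>p i. u p $$ i)" for S
    using xb[OF that] Xx unfolding exp_bounded_def by simp
  ultimately show ?thesis using X by (intro exI[of _ X] conjI allI impI)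
qed

lemma mat_damped_shift_fixed_point_eq_0:
  assumes P: "P \<in> carrier_mat n n" and Q: "Q \<in> carrier_mat m m" and x: "\<And>p. x p \<in> carrier_mat n m"
    and d: "d \<ge> 1" and \<kappa>: "norm \<kappa> < 1" and R: "R > 0"
    and eb: "exp_bounded ({..<n} \<times> {..<m}) R (\<lambda>p i. x p $$ i)"
    and fixp: "\<And>p. x p = \<kappa> ^ p \<cdot>\<^sub>m (P * x (p + d) * Q)"
  shows "x p = 0\<^sub>m n m"
proof (rule eq_matI)
  fix a b assume "a < dim_row (0\<^sub>m n m :: complex mat)" "b < dim_col (0\<^sub>m n m :: complex mat)"
  then have ab: "a < n" "b < m" by auto
  have "x p $$ (a, b) = 0"
  proof (rule damped_shift_fixed_point_eq_0[OF _ d \<kappa> R eb])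
    fix p i assume i: "i \<in> {..<n} \<times> {..<m}"
    show "x p $$ i = damped_shift ({..<n} \<times> {..<m}) d \<kappa> (\<lambda>(a, b) (i, j). P $$ (a, i) * Q $$ (j, b))
      (\<lambda>p i. x p $$ i) p i"
      using i damped_shift_mat[OF P Q x, where a = "fst i" and b = "snd i" and d = d and \<kappa> = \<kappa> and p = p]
        fixp[of p] by auto
  qed (use ab in auto)
  with ab show "x p $$ (a, b) = 0\<^sub>m n m $$ (a, b)" by simp
qed (use x[of p] in auto)

lemma exp_bounded_mult_mat:
  assumes P: "P \<in> carrier_mat n n" and Q: "Q \<in> carrier_mat m m" and u: "\<And>p. u p \<in> carrier_mat n m"
    and S: "S > 0" and eb: "exp_bounded ({..<n} \<times> {..<m}) S (\<lambda>p i. u p $$ i)"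
    and c: "\<And>p. norm (c p) \<le> c0"
  shows "exp_bounded ({..<n} \<times> {..<m}) S (\<lambda>p i. (c p \<cdot>\<^sub>m (P * u p * Q)) $$ i)"
proof -
  let ?I = "{..<n} \<times> {..<m}"
  from eb obtain C where C0: "\<forall>p. \<forall>i\<in>?I. norm (u p $$ i) \<le> C * S ^ p"
    unfolding exp_bounded_def by (elim exE)
  have C: "norm (u p $$ i) \<le> C * S ^ p" if "i \<in> ?I" for p i
    by (rule C0[rule_format, OF that])
  define g where "g = (\<lambda>(a, b). \<Sum>(i, j)\<in>?I. norm (P $$ (a, i)) * norm (Q $$ (j, b)))"
  define K where "K = sum g ?I"
  have g: "g i \<ge> 0" for i by (auto simp: g_def case_prod_unfold intro!: sum_nonneg)
  have c0: "c0 \<ge> 0" using c[of 0] norm_ge_zero[of "c 0"] by linarith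
  have "norm ((c p \<cdot>\<^sub>m (P * u p * Q)) $$ (a, b)) \<le> (c0 * (K * C)) * S ^ p" if ab: "a < n" "b < m" for p a b
  proof -
    have CS: "0 \<le> C * S ^ p"
      using order_trans[OF norm_ge_zero C[of "(a, b)" p]] ab by simp
    have "norm ((P * u p * Q) $$ (a, b)) \<le>
        (\<Sum>(i, j)\<in>?I. norm (P $$ (a, i)) * norm (Q $$ (j, b)) * (C * S ^ p))"
      unfolding mult_mat_index_sum3[OF P u Q ab] case_prod_unfold
      by (rule order_trans[OF norm_sum]) (auto simp: norm_mult intro!: sum_mono mult_left_mono C)
    also have "\<dots> = g (a, b) * (C * S ^ p)"
      by (simp add: g_def case_prod_unfold sum_distrib_right)
    also have "\<dots> \<le> K * (C * S ^ p)"
      unfolding K_def using CS ab g by (intro mult_right_mono member_le_sum) auto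
    finally have *: "norm ((P * u p * Q) $$ (a, b)) \<le> K * (C * S ^ p)" .
    have "norm ((c p \<cdot>\<^sub>m (P * u p * Q)) $$ (a, b)) = norm (c p) * norm ((P * u p * Q) $$ (a, b))"
      using P Q ab by (simp add: norm_mult)
    also have "\<dots> \<le> c0 * (K * (C * S ^ p))"
      using * c c0 by (intro mult_mono) auto
    finally show ?thesis by (simp add: mult_ac)
  qed
  then show ?thesis unfolding exp_bounded_def by (intro exI[of _ "c0 * (K * C)"]) auto
qed

text \<open>
  Cutting a two-sided sequence at any place \<open>s\<close> and numbering both halves outwards turns the
  growth condition for Laurent coefficients into geometric bounds, of rate \<open>1 / \<rho>\<close> on the right
  half and \<open>\<rho>\<close> on the left half.
\<close>

lemma laurent_bounded_iff_halves:
  assumes I: "finite I"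
  shows "(\<forall>i\<in>I. laurent_bounded (\<lambda>n. x n i) R) \<longleftrightarrow>
    (\<forall>\<rho>. 0 < \<rho> \<and> \<rho> < R \<longrightarrow> exp_bounded I (1 / \<rho>) (\<lambda>p. x (s + int p)) \<and>
       exp_bounded I \<rho> (\<lambda>p. x (s - 1 - int p)))" (is "?L \<longleftrightarrow> ?H")
proof
  assume L: ?L
  show ?H
  proof (intro allI impI)
    fix \<rho> assume \<rho>: "0 < \<rho> \<and> \<rho> < R"
    with L have "\<forall>i\<in>I. \<exists>C. \<forall>n. norm (x n i) \<le> C * \<rho> powi (-n)"
      unfolding laurent_bounded_def by blast
    from bchoice[OF this] obtain C where C: "\<And>i n. i \<in> I \<Longrightarrow> norm (x n i) \<le> C i * \<rho> powi (-n)"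
      by blast
    define C0 where "C0 = (\<Sum>i\<in>I. \<bar>C i\<bar>)"
    have C0: "norm (x n i) \<le> C0 * \<rho> powi (-n)" if i: "i \<in> I" for i n
    proof -
      have "C i \<le> C0" unfolding C0_def
        using member_le_sum[of i I "\<lambda>i. \<bar>C i\<bar>"] i I by auto
      then have "C i * \<rho> powi (-n) \<le> C0 * \<rho> powi (-n)" using \<rho> by (intro mult_right_mono) auto
      with C[OF i, of n] show ?thesis by linarith
    qed
    have e1: "\<rho> powi (-(s + int p)) = \<rho> powi (-s) * (1 / \<rho>) ^ p" for p
      using \<rho> by (simp add: power_int_add power_int_minus power_int_diff field_simps)
    have e2: "\<rho> powi (-(s - 1 - int p)) = \<rho> powi (1 - s) * \<rho> ^ p" for p
      using \<rho> power_int_add[of \<rho> "1 - s" "int p"] by (simp add: algebra_simps)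
    have "exp_bounded I (1 / \<rho>) (\<lambda>p. x (s + int p))"
      unfolding exp_bounded_def
    proof (intro exI[of _ "C0 * \<rho> powi (-s)"] allI ballI)
      fix p i assume "i \<in> I"
      from C0[OF this, of "s + int p"] show "norm (x (s + int p) i) \<le> C0 * \<rho> powi (-s) * (1 / \<rho>) ^ p"
        unfolding e1 by (simp only: mult.assoc)
    qed
    moreover have "exp_bounded I \<rho> (\<lambda>p. x (s - 1 - int p))"
      unfolding exp_bounded_def
    proof (intro exI[of _ "C0 * \<rho> powi (1 - s)"] allI ballI)
      fix p i assume "i \<in> I"
      from C0[OF this, of "s - 1 - int p"] show "norm (x (s - 1 - int p) i) \<le> C0 * \<rho> powi (1 - s) * \<rho> ^ p"
        unfolding e2 by (simp only: mult.assoc)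
    qed
    ultimately show "exp_bounded I (1 / \<rho>) (\<lambda>p. x (s + int p)) \<and> exp_bounded I \<rho> (\<lambda>p. x (s - 1 - int p))" ..
  qed
next
  assume H: ?H
  show ?L
  proof (intro ballI, unfold laurent_bounded_def, intro allI impI)
    fix i \<rho> assume i: "i \<in> I" and \<rho>: "0 < \<rho> \<and> \<rho> < R"
    from H[rule_format, OF \<rho>] obtain C1 C2
      where "\<forall>p. \<forall>i\<in>I. norm (x (s + int p) i) \<le> C1 * (1 / \<rho>) ^ p"
        and "\<forall>p. \<forall>i\<in>I. norm (x (s - 1 - int p) i) \<le> C2 * \<rho> ^ p"
      unfolding exp_bounded_def by (elim exE conjE)
    with i have C1: "norm (x (s + int p) i) \<le> C1 * (1 / \<rho>) ^ p"
      and C2: "norm (x (s - 1 - int p) i) \<le> C2 * \<rho> ^ p" for p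
      by auto
    define C where "C = max (\<bar>C1\<bar> * \<rho> powi s) (\<bar>C2\<bar> * \<rho> powi (s - 1))"
    have "norm (x n i) \<le> C * \<rho> powi (-n)" for n
    proof (cases "n \<ge> s")
      case True
      then obtain p where n: "n = s + int p" by (metis zle_iff_zadd)
      have "norm (x n i) \<le> C1 * (1 / \<rho>) ^ p" using C1 n by simp
      also have "\<dots> \<le> \<bar>C1\<bar> * (1 / \<rho>) ^ p" using \<rho> by (intro mult_right_mono) auto
      also have "(1 / \<rho>) ^ p = \<rho> powi s * \<rho> powi (-n)"
        using \<rho> by (simp add: n power_int_add power_int_minus power_int_diff field_simps)
      also have "\<bar>C1\<bar> * (\<rho> powi s * \<rho> powi (-n)) \<le> C * \<rho> powi (-n)"
        using \<rho> by (auto simp: C_def mult.assoc[symmetric] intro!: mult_right_mono)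
      finally show ?thesis .
    next
      case False
      then obtain p where n: "n = s - 1 - int p"
        by (intro that[of "nat (s - 1 - n)"]) auto
      have "norm (x n i) \<le> C2 * \<rho> ^ p" using C2 n by simp
      also have "\<dots> \<le> \<bar>C2\<bar> * \<rho> ^ p" using \<rho> by (intro mult_right_mono) auto
      also have "\<rho> ^ p = \<rho> powi (s - 1) * \<rho> powi (-n)"
        using \<rho> power_int_add[of \<rho> "s - 1" "-n"] by (simp add: n)
      also have "\<bar>C2\<bar> * (\<rho> powi (s - 1) * \<rho> powi (-n)) \<le> C * \<rho> powi (-n)"
        using \<rho> by (auto simp: C_def mult.assoc[symmetric] intro!: mult_right_mono)
      finally show ?thesis .
    qed
    then show "\<exists>C. \<forall>n. norm (x n i) \<le> C * \<rho> powi (-n)" by blast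
  qed
qed

text \<open>
  The coefficient equation relates \<open>X = X\<^bsub>n+\<nu>\<^esub>\<close> and \<open>Z = X\<^bsub>n+\<mu>\<^esub>\<close>. It has to be solved for the one nearer to the
  middle: for \<open>Z\<close> on the lower half, as here, and for \<open>X\<close> on the upper half, as in
  \<open>mat_eq_solve_right\<close>.
\<close>

lemma mat_eq_solve_left:
  fixes A :: "'a :: field mat"
  assumes A: "A \<in> carrier_mat n n" "A' \<in> carrier_mat n n" "A * A' = 1\<^sub>m n" "A' * A = 1\<^sub>m n"
    and B: "B \<in> carrier_mat m m" and X: "X \<in> carrier_mat n m" and Z: "Z \<in> carrier_mat n m"
    and W: "W \<in> carrier_mat n m"
  shows "c \<cdot>\<^sub>m (X * B) + W = A * Z \<longleftrightarrow> Z = A' * W + c \<cdot>\<^sub>m (A' * X * B)"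
proof -
  have XB: "X * B \<in> carrier_mat n m" and AW: "A' * W \<in> carrier_mat n m" and AXB: "A' * X * B \<in> carrier_mat n m"
    using A B X W by auto
  have eq: "A' * W + c \<cdot>\<^sub>m (A' * X * B) = A' * (c \<cdot>\<^sub>m (X * B) + W)"
  proof -
    have "A' * (c \<cdot>\<^sub>m (X * B) + W) = c \<cdot>\<^sub>m (A' * X * B) + A' * W"
      using A B X W XB
      by (simp add: mult_add_distrib_mat[of _ n n _ m] mult_smult_distrib[of _ n n _ m]
          assoc_mult_mat[of _ n n _ m _ m])
    also have "\<dots> = A' * W + c \<cdot>\<^sub>m (A' * X * B)"
      by (rule comm_add_mat[of _ n m]) (use AW AXB in auto)
    finally show ?thesis by simp
  qed
  have can: "A * (A' * Y) = Y" "A' * (A * Y) = Y" if "Y \<in> carrier_mat n m" for Y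
    using A that assoc_mult_mat[of A n n A' n Y m] assoc_mult_mat[of A' n n A n Y m] by simp_all
  have V: "c \<cdot>\<^sub>m (X * B) + W \<in> carrier_mat n m" using XB W by auto
  from can(1)[OF V] can(2)[OF Z] show ?thesis unfolding eq by metis
qed

lemma mat_eq_smult_add_iff:
  fixes X :: "'a :: field mat"
  assumes "X \<in> carrier_mat n m" "Y \<in> carrier_mat n m" "Z \<in> carrier_mat n m" "c \<noteq> 0"
  shows "c \<cdot>\<^sub>m X + Y = Z \<longleftrightarrow> X = (- inverse c) \<cdot>\<^sub>m Y + inverse c \<cdot>\<^sub>m Z"
proof -
  have "c * x + y = z \<longleftrightarrow> x = - inverse c * y + inverse c * z" for x y z
    using assms(4) by (auto simp: field_simps)
  then show ?thesis using assms(1-3) by (auto simp: mat_eq_iff)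
qed

lemma mat_eq_solve_right:
  fixes A :: "'a :: field mat"
  assumes A: "A \<in> carrier_mat n n" and B: "B \<in> carrier_mat m m" "B' \<in> carrier_mat m m" "B * B' = 1\<^sub>m m" "B' * B = 1\<^sub>m m"
    and X: "X \<in> carrier_mat n m" and Z: "Z \<in> carrier_mat n m"
    and W: "W \<in> carrier_mat n m" and c: "c \<noteq> 0"
  shows "c \<cdot>\<^sub>m (X * B) + W = A * Z \<longleftrightarrow> X = (- inverse c) \<cdot>\<^sub>m (W * B') + inverse c \<cdot>\<^sub>m (A * Z * B')"
proof -
  have c1: "W * B' \<in> carrier_mat n m" "A * Z \<in> carrier_mat n m" "A * Z * B' \<in> carrier_mat n m"
    "X * B \<in> carrier_mat n m" "W * B' * B \<in> carrier_mat n m" "A * Z * B' * B \<in> carrier_mat n m"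
    using A B X W Z by auto
  have can: "Y * B' * B = Y" "Y * B * B' = Y" if "Y \<in> carrier_mat n m" for Y
    using that B assoc_mult_mat[of Y n m B m B' m] assoc_mult_mat[of Y n m B' m B m] by simp_all
  have "c \<cdot>\<^sub>m (X * B) + W = A * Z \<longleftrightarrow> c \<cdot>\<^sub>m X + W * B' = A * Z * B'"
  proof
    assume eq: "c \<cdot>\<^sub>m (X * B) + W = A * Z"
    show "c \<cdot>\<^sub>m X + W * B' = A * Z * B'"
      unfolding eq[symmetric]
      using c1 B W by (simp add: add_mult_distrib_mat[of _ n m _ _ m] mult_smult_assoc_mat[of _ n m _ m] can[OF X])
  next
    assume eq: "c \<cdot>\<^sub>m X + W * B' = A * Z * B'"
    have "A * Z = A * Z * B' * B" using can c1 by simp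
    also have "\<dots> = c \<cdot>\<^sub>m (X * B) + W"
      unfolding eq[symmetric]
      using c1 B X W by (simp add: add_mult_distrib_mat[of _ n m _ _ m] mult_smult_assoc_mat[of _ n m _ m] can[OF W])
    finally show "c \<cdot>\<^sub>m (X * B) + W = A * Z" by simp
  qed
  then show ?thesis
    using mat_eq_smult_add_iff[OF X c1(1,3) c] by simp
qed

section \<open>The recurrence satisfied by the Laurent coefficients\<close>

lemma inverse_powi_add_nat:
  fixes q :: complex
  assumes "q \<noteq> 0"
  shows "inverse (q powi (s + int p)) = inverse q ^ p * q powi (-s)"
  using assms by (simp add: power_int_add power_int_minus power_inverse)

lemma smult_smult_mat: "(k :: 'a :: semigroup_mult) \<cdot>\<^sub>m (l \<cdot>\<^sub>m X) = (k * l) \<cdot>\<^sub>m X"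
  by (rule eq_matI) (auto simp: mult.assoc)

text \<open>
  The equations between the coefficients of \<open>z\<^sup>n\<close> for those \<open>n\<close> at which the normal form has no term.
\<close>

definition coeff_recurrence :: "complex \<Rightarrow> int \<Rightarrow> int \<Rightarrow> complex mat \<Rightarrow> complex mat \<Rightarrow>
    (int \<Rightarrow> complex mat) \<Rightarrow> (int \<Rightarrow> complex mat) \<Rightarrow> bool" where
  "coeff_recurrence q \<mu> \<nu> A B w x \<longleftrightarrow>
     (\<forall>n. n < \<nu> \<or> \<mu> \<le> n \<longrightarrow> q powi (n + \<nu>) \<cdot>\<^sub>m (x (n + \<nu>) * B) + w n = A * x (n + \<mu>))"

context
  fixes q :: complex and r m :: nat and \<mu> \<nu> :: int and A A' B B' :: "complex mat"
  assumes q: "norm q > 1" and \<nu>\<mu>: "\<nu> < \<mu>"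
    and A: "A \<in> carrier_mat r r" "A' \<in> carrier_mat r r" "A * A' = 1\<^sub>m r" "A' * A = 1\<^sub>m r"
    and B: "B \<in> carrier_mat m m" "B' \<in> carrier_mat m m" "B * B' = 1\<^sub>m m" "B' * B = 1\<^sub>m m"
begin

text \<open>
  The gap \<open>\<nu> \<le> n < \<mu>\<close> has the same length as the shift between the two unknowns in each equation. Therefore
  the equations above the gap and those below it have no unknown in common, and each of the unknowns
  occurs on the left-hand side of exactly one equation. Here \<open>p\<close> counts \<open>n\<close> upwards from
  \<open>\<mu>\<close> and downwards from \<open>\<nu> - 1\<close>; the unknowns are cut at \<open>\<mu> + \<nu>\<close>.
\<close>

lemma coeff_recurrence_iff_halves:
  assumes w: "\<And>n. w n \<in> carrier_mat r m" and x: "\<And>n. x n \<in> carrier_mat r m"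
  shows "coeff_recurrence q \<mu> \<nu> A B w x \<longleftrightarrow>
    (\<forall>p. x (\<mu> + \<nu> + int p) = (- inverse (q powi (\<mu> + \<nu> + int p))) \<cdot>\<^sub>m (w (\<mu> + int p) * B') +
      inverse q ^ p \<cdot>\<^sub>m ((q powi (-(\<mu> + \<nu>)) \<cdot>\<^sub>m A) * x (\<mu> + \<nu> + int (p + nat (\<mu> - \<nu>))) * B')) \<and>
    (\<forall>p. x (\<mu> + \<nu> - 1 - int p) = A' * w (\<nu> - 1 - int p) +
      inverse q ^ p \<cdot>\<^sub>m ((q powi (2 * \<nu> - 1) \<cdot>\<^sub>m A') * x (\<mu> + \<nu> - 1 - int (p + nat (\<mu> - \<nu>))) * B))"
    (is "_ \<longleftrightarrow> (\<forall>p. ?P p) \<and> (\<forall>p. ?M p)")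
proof -
  have q0: "q \<noteq> 0" using q by auto
  let ?E = "\<lambda>n. q powi (n + \<nu>) \<cdot>\<^sub>m (x (n + \<nu>) * B) + w n = A * x (n + \<mu>)"
  have idx: "(\<forall>n. n < \<nu> \<or> \<mu> \<le> n \<longrightarrow> E n) \<longleftrightarrow> (\<forall>p. E (\<mu> + int p)) \<and> (\<forall>p. E (\<nu> - 1 - int p))"
    for E :: "int \<Rightarrow> bool"
  proof (intro iffI conjI allI impI)
    fix n assume H: "(\<forall>p. E (\<mu> + int p)) \<and> (\<forall>p. E (\<nu> - 1 - int p))" and n: "n < \<nu> \<or> \<mu> \<le> n"
    show "E n"
    proof (cases "\<mu> \<le> n")
      case True
      with H[THEN conjunct1, rule_format, of "nat (n - \<mu>)"] show ?thesis by simp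
    next
      case False
      with n H[THEN conjunct2, rule_format, of "nat (\<nu> - 1 - n)"] show ?thesis by simp
    qed
  qed (use \<nu>\<mu> in auto)
  have "?E (\<mu> + int p) \<longleftrightarrow> ?P p" for p
  proof -
    have i: "\<mu> + int p + \<nu> = \<mu> + \<nu> + int p" "\<mu> + int p + \<mu> = \<mu> + \<nu> + int (p + nat (\<mu> - \<nu>))"
      using \<nu>\<mu> by auto
    have "inverse (q powi (\<mu> + \<nu> + int p)) = inverse q ^ p * q powi (-(\<mu> + \<nu>))"
      by (rule inverse_powi_add_nat[OF q0])
    then have "inverse (q powi (\<mu> + \<nu> + int p)) \<cdot>\<^sub>m (A * Z * B') =
        inverse q ^ p \<cdot>\<^sub>m ((q powi (-(\<mu> + \<nu>)) \<cdot>\<^sub>m A) * Z * B')"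
      if "Z \<in> carrier_mat r m" for Z
      using that A B
      by (simp add: mult_smult_assoc_mat[of _ r r _ m] mult_smult_assoc_mat[of _ r m _ m] smult_smult_mat)
    with mat_eq_solve_right[OF A(1) B x x w, of "q powi (\<mu> + \<nu> + int p)"] q0 x show ?thesis
      unfolding i by simp
  qed
  moreover have "?E (\<nu> - 1 - int p) \<longleftrightarrow> ?M p" for p
  proof -
    have i: "\<nu> - 1 - int p + \<mu> = \<mu> + \<nu> - 1 - int p"
       "\<nu> - 1 - int p + \<nu> = \<mu> + \<nu> - 1 - int (p + nat (\<mu> - \<nu>))"
      using \<nu>\<mu> by auto
    have "\<mu> + \<nu> - 1 - int (p + nat (\<mu> - \<nu>)) = (2 * \<nu> - 1) - int p" using \<nu>\<mu> by simp
    moreover have "q powi ((2 * \<nu> - 1) - int p) = q powi (2 * \<nu> - 1) / q powi int p"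
      by (rule power_int_diff) (simp add: q0)
    ultimately have "q powi (\<mu> + \<nu> - 1 - int (p + nat (\<mu> - \<nu>))) = inverse q ^ p * q powi (2 * \<nu> - 1)"
      by (simp only: power_int_of_nat divide_inverse power_inverse mult.commute)
    then have "q powi (\<mu> + \<nu> - 1 - int (p + nat (\<mu> - \<nu>))) \<cdot>\<^sub>m (A' * Z * B) =
        inverse q ^ p \<cdot>\<^sub>m ((q powi (2 * \<nu> - 1) \<cdot>\<^sub>m A') * Z * B)"
      if "Z \<in> carrier_mat r m" for Z
      using that A B
      by (simp add: mult_smult_assoc_mat[of _ r r _ m] mult_smult_assoc_mat[of _ r m _ m] smult_smult_mat)
    with mat_eq_solve_left[OF A B(1) x x w, of "q powi (\<mu> + \<nu> - 1 - int (p + nat (\<mu> - \<nu>)))"] x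
    show ?thesis
      unfolding i by simp
  qed
  ultimately show ?thesis unfolding coeff_recurrence_def idx by simp
qed

lemma coeff_recurrence_solution:
  assumes w: "\<And>n. w n \<in> carrier_mat r m" and R: "R > 0"
    and wb: "\<And>i. i \<in> {..<r} \<times> {..<m} \<Longrightarrow> laurent_bounded (\<lambda>n. w n $$ i) R"
  shows "\<exists>x. (\<forall>n. x n \<in> carrier_mat r m) \<and> coeff_recurrence q \<mu> \<nu> A B w x \<and>
             (\<forall>i\<in>{..<r} \<times> {..<m}. laurent_bounded (\<lambda>n. x n $$ i) R)"
proof -
  let ?I = "{..<r} \<times> {..<m}"
  define d where "d = nat (\<mu> - \<nu>)"
  have d: "d \<ge> 1" using \<nu>\<mu> by (simp add: d_def)
  have q0: "q \<noteq> 0" using q by auto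
  have \<kappa>: "norm (inverse q) < 1" using q by (simp add: norm_inverse inverse_less_1_iff)
  note halves = laurent_bounded_iff_halves[of ?I _ R]
  have wb': "\<forall>i\<in>?I. laurent_bounded (\<lambda>n. w n $$ i) R" using wb by blast
  \<comment> \<open>The inhomogeneous terms of the recurrences on the upper and on the lower half.\<close>
  define up where "up = (\<lambda>p. (- inverse (q powi (\<mu> + \<nu> + int p))) \<cdot>\<^sub>m (w (\<mu> + int p) * B'))"
  define um where "um = (\<lambda>p. A' * w (\<nu> - 1 - int p))"
  have up: "up p \<in> carrier_mat r m" and um: "um p \<in> carrier_mat r m" for p
    unfolding up_def um_def using mult_carrier_mat[OF w B(2)] mult_carrier_mat[OF A(2) w] by (simp_all del: uminus_carrier_iff_mat)
  have upb: "exp_bounded ?I (1 / \<rho>) (\<lambda>p i. up p $$ i)" if "0 < \<rho>" "\<rho> < R" for \<rho>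
  proof -
    have "norm (- inverse (q powi (\<mu> + \<nu> + int p))) \<le> norm (q powi (-(\<mu> + \<nu>)))" for p
    proof -
      have "- inverse (q powi (\<mu> + \<nu> + int p)) = - (q powi (-(\<mu> + \<nu>)) * inverse q ^ p)"
        unfolding inverse_powi_add_nat[OF q0] by (simp only: mult.commute)
      then have "norm (- inverse (q powi (\<mu> + \<nu> + int p))) = norm (q powi (-(\<mu> + \<nu>))) * norm (inverse q) ^ p"
        by (simp only: norm_minus_cancel norm_mult norm_power)
      also have "\<dots> \<le> norm (q powi (-(\<mu> + \<nu>))) * 1"
        using \<kappa> by (intro mult_left_mono power_le_one) auto
      finally show ?thesis by simp
    qed
    moreover have "exp_bounded ?I (1 / \<rho>) (\<lambda>p i. w (\<mu> + int p) $$ i)"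
      using wb' that unfolding halves[of "\<lambda>n i. w n $$ i" \<mu>, OF finite_cartesian_product[OF finite_lessThan finite_lessThan]]
      by blast
    ultimately have "exp_bounded ?I (1 / \<rho>)
        (\<lambda>p i. (- inverse (q powi (\<mu> + \<nu> + int p)) \<cdot>\<^sub>m (1\<^sub>m r * w (\<mu> + int p) * B')) $$ i)"
      by (intro exp_bounded_mult_mat[OF _ B(2) w]) (use that in auto)
    then show ?thesis unfolding up_def using w by (simp add: left_mult_one_mat[OF w])
  qed
  have umb: "exp_bounded ?I \<rho> (\<lambda>p i. um p $$ i)" if "0 < \<rho>" "\<rho> < R" for \<rho>
  proof -
    have "exp_bounded ?I \<rho> (\<lambda>p i. w (\<nu> - 1 - int p) $$ i)"
      using wb' that unfolding halves[of "\<lambda>n i. w n $$ i" \<nu>, OF finite_cartesian_product[OF finite_lessThan finite_lessThan]]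
      by blast
    then have "exp_bounded ?I \<rho> (\<lambda>p i. (1 \<cdot>\<^sub>m (A' * w (\<nu> - 1 - int p) * 1\<^sub>m m)) $$ i)"
      by (intro exp_bounded_mult_mat[OF A(2) _ w, where c = "\<lambda>_. 1" and ?c0.0 = "1"]) (use that in auto)
    moreover have "1 \<cdot>\<^sub>m (A' * w (\<nu> - 1 - int p) * 1\<^sub>m m) = um p" for p
      unfolding right_mult_one_mat[OF um[of p, unfolded um_def]] by (rule eq_matI) (auto simp: um_def)
    ultimately show ?thesis by simp
  qed
  \<comment> \<open>Some rate at which the inhomogeneous terms are bounded is needed for the series to converge.\<close>
  have R2: "0 < R / 2" "R / 2 < R" using R by auto
  have Pp: "q powi (-(\<mu> + \<nu>)) \<cdot>\<^sub>m A \<in> carrier_mat r r" and Pm: "q powi (2 * \<nu> - 1) \<cdot>\<^sub>m A' \<in> carrier_mat r r"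
    using A by auto
  have "1 / (R / 2) > 0" using R by simp
  from mat_damped_shift_solution[OF Pp B(2) up d \<kappa> this upb[OF R2]]
  obtain xp where xp0: "(\<forall>p. xp p \<in> carrier_mat r m) \<and>
      (\<forall>p. xp p = up p + inverse q ^ p \<cdot>\<^sub>m ((q powi (-(\<mu> + \<nu>)) \<cdot>\<^sub>m A) * xp (p + d) * B')) \<and>
      (\<forall>S>0. exp_bounded ?I S (\<lambda>p i. up p $$ i) \<longrightarrow> exp_bounded ?I S (\<lambda>p i. xp p $$ i))"
    by (rule exE)
  note xp = xp0[THEN conjunct1] xp0[THEN conjunct2, THEN conjunct1]
    and xpb = xp0[THEN conjunct2, THEN conjunct2]
  from mat_damped_shift_solution[OF Pm B(1) um d \<kappa> R2(1) umb[OF R2]]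
  obtain xm where xm0: "(\<forall>p. xm p \<in> carrier_mat r m) \<and>
      (\<forall>p. xm p = um p + inverse q ^ p \<cdot>\<^sub>m ((q powi (2 * \<nu> - 1) \<cdot>\<^sub>m A') * xm (p + d) * B)) \<and>
      (\<forall>S>0. exp_bounded ?I S (\<lambda>p i. um p $$ i) \<longrightarrow> exp_bounded ?I S (\<lambda>p i. xm p $$ i))"
    by (rule exE)
  note xm = xm0[THEN conjunct1] xm0[THEN conjunct2, THEN conjunct1]
    and xmb = xm0[THEN conjunct2, THEN conjunct2]
  define x where "x = (\<lambda>n. if n \<ge> \<mu> + \<nu> then xp (nat (n - (\<mu> + \<nu>))) else xm (nat (\<mu> + \<nu> - 1 - n)))"
  have x: "x n \<in> carrier_mat r m" for n by (simp add: x_def xp(1) xm(1))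
  have xx: "x (\<mu> + \<nu> + int p) = xp p" "x (\<mu> + \<nu> - 1 - int p) = xm p" for p
    by (simp_all add: x_def)
  have "coeff_recurrence q \<mu> \<nu> A B w x"
    unfolding coeff_recurrence_iff_halves[OF w x] xx
    using xp(2) xm(2) unfolding up_def um_def d_def by (intro conjI)
  moreover have "\<forall>i\<in>?I. laurent_bounded (\<lambda>n. x n $$ i) R"
    unfolding halves[of "\<lambda>n i. x n $$ i" "\<mu> + \<nu>", OF finite_cartesian_product[OF finite_lessThan finite_lessThan]] xx
    using upb umb xpb xmb by simp
  ultimately show ?thesis using x by blast
qed

lemma coeff_recurrence_homogeneous_eq_0:
  assumes x: "\<And>n. x n \<in> carrier_mat r m" and rec: "coeff_recurrence q \<mu> \<nu> A B (\<lambda>_. 0\<^sub>m r m) x"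
    and R: "R > 0" and xb: "\<And>i. i \<in> {..<r} \<times> {..<m} \<Longrightarrow> laurent_bounded (\<lambda>n. x n $$ i) R"
  shows "x n = 0\<^sub>m r m"
proof -
  let ?I = "{..<r} \<times> {..<m}"
  define d where "d = nat (\<mu> - \<nu>)"
  have d: "d \<ge> 1" using \<nu>\<mu> by (simp add: d_def)
  have \<kappa>: "norm (inverse q) < 1" using q by (simp add: norm_inverse inverse_less_1_iff)
  have Pp: "q powi (-(\<mu> + \<nu>)) \<cdot>\<^sub>m A \<in> carrier_mat r r" and Pm: "q powi (2 * \<nu> - 1) \<cdot>\<^sub>m A' \<in> carrier_mat r r"
    using A by auto
  have "\<forall>i\<in>?I. laurent_bounded (\<lambda>n. x n $$ i) R" using xb by blast
  then have eb0: "\<forall>\<rho>. 0 < \<rho> \<and> \<rho> < R \<longrightarrow>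
      exp_bounded ?I (1 / \<rho>) (\<lambda>p i. x (\<mu> + \<nu> + int p) $$ i) \<and>
      exp_bounded ?I \<rho> (\<lambda>p i. x (\<mu> + \<nu> - 1 - int p) $$ i)"
    unfolding laurent_bounded_iff_halves[of ?I "\<lambda>n i. x n $$ i" R "\<mu> + \<nu>",
        OF finite_cartesian_product[OF finite_lessThan finite_lessThan]] .
  have eb: "exp_bounded ?I (1 / (R / 2)) (\<lambda>p i. x (\<mu> + \<nu> + int p) $$ i)"
    "exp_bounded ?I (R / 2) (\<lambda>p i. x (\<mu> + \<nu> - 1 - int p) $$ i)"
    using eb0[rule_format, of "R / 2"] R by simp_all
  have z: "0\<^sub>m r m * B' = 0\<^sub>m r m" "A' * 0\<^sub>m r m = 0\<^sub>m r m" "c \<cdot>\<^sub>m 0\<^sub>m r m = 0\<^sub>m r m" for c :: complex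
    using A B by auto
  have cp: "inverse q ^ p \<cdot>\<^sub>m ((q powi (-(\<mu> + \<nu>)) \<cdot>\<^sub>m A) * x n * B') \<in> carrier_mat r m"
    "inverse q ^ p \<cdot>\<^sub>m ((q powi (2 * \<nu> - 1) \<cdot>\<^sub>m A') * x n * B) \<in> carrier_mat r m" for p n
    using Pp Pm A B x by auto
  from rec have rp: "x (\<mu> + \<nu> + int p) =
      inverse q ^ p \<cdot>\<^sub>m ((q powi (-(\<mu> + \<nu>)) \<cdot>\<^sub>m A) * x (\<mu> + \<nu> + int (p + d)) * B')"
    and rm: "x (\<mu> + \<nu> - 1 - int p) =
      inverse q ^ p \<cdot>\<^sub>m ((q powi (2 * \<nu> - 1) \<cdot>\<^sub>m A') * x (\<mu> + \<nu> - 1 - int (p + d)) * B)" for p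
    unfolding coeff_recurrence_iff_halves[OF zero_carrier_mat x] z d_def[symmetric]
      left_add_zero_mat[OF cp(1)] left_add_zero_mat[OF cp(2)]
    by blast+
  have 1: "x (\<mu> + \<nu> + int p) = 0\<^sub>m r m" for p
    by (rule mat_damped_shift_fixed_point_eq_0[OF Pp B(2) x d \<kappa> _ eb(1) rp]) (use R in auto)
  have 2: "x (\<mu> + \<nu> - 1 - int p) = 0\<^sub>m r m" for p
    by (rule mat_damped_shift_fixed_point_eq_0[OF Pm B(1) x d \<kappa> _ eb(2) rm]) (use R in auto)
  show ?thesis
    using 1[of "nat (n - (\<mu> + \<nu>))"] 2[of "nat (\<mu> + \<nu> - 1 - n)"]
    by (cases "n \<ge> \<mu> + \<nu>") simp_all
qed

end

section \<open>The equation for a single off-diagonal block\<close>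

definition coeff_mat :: "germ mat \<Rightarrow> int \<Rightarrow> complex mat" where
  "coeff_mat X n = map_mat (\<lambda>f. laurent_coeff f n) X"

lemma coeff_mat_carrier [simp]: "coeff_mat X n \<in> carrier_mat r m \<longleftrightarrow> X \<in> carrier_mat r m"
  by (auto simp: coeff_mat_def)

lemma coeff_mat_index:
  "X \<in> carrier_mat r m \<Longrightarrow> a < r \<Longrightarrow> b < m \<Longrightarrow> coeff_mat X n $$ (a, b) = laurent_coeff (X $$ (a, b)) n"
  by (simp add: coeff_mat_def)

lemma coeff_mat_eqI:
  assumes "X \<in> carrier_mat r m" "Y \<in> carrier_mat r m" "\<And>n. coeff_mat X n = coeff_mat Y n"
  shows "X = Y"
proof (rule eq_matI)
  fix a b assume "a < dim_row Y" "b < dim_col Y"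
  then have ab: "a < r" "b < m" using assms by auto
  show "X $$ (a, b) = Y $$ (a, b)"
    by (rule germ_eqI) (metis assms ab coeff_mat_index)
qed (use assms in auto)

lemma coeff_mat_add:
  "X \<in> carrier_mat r m \<Longrightarrow> Y \<in> carrier_mat r m \<Longrightarrow> coeff_mat (X + Y) n = coeff_mat X n + coeff_mat Y n"
  by (intro eq_matI) (auto simp: coeff_mat_def laurent_coeff_add)

lemma laurent_coeff_minus: "laurent_coeff (f - g) n = laurent_coeff f n - laurent_coeff g n"
  using laurent_coeff_add[of "f - g" g n] by simp

lemma coeff_mat_minus:
  "X \<in> carrier_mat r m \<Longrightarrow> Y \<in> carrier_mat r m \<Longrightarrow> coeff_mat (X - Y) n = coeff_mat X n - coeff_mat Y n"
  by (intro eq_matI) (auto simp: coeff_mat_def laurent_coeff_minus)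

lemma coeff_mat_sigma:
  "q \<noteq> 0 \<Longrightarrow> coeff_mat (map_mat (sigma q) X) n = q powi n \<cdot>\<^sub>m coeff_mat X n"
  by (intro eq_matI) (auto simp: coeff_mat_def laurent_coeff_sigma)

lemma laurent_coeff_monomial_mult:
  "laurent_coeff (germ_zpow k * germ_const c * f) n = c * laurent_coeff f (n - k)"
  by (simp add: mult.assoc laurent_coeff_zpow_mult laurent_coeff_const_mult)

lemma coeff_mat_mult_right:
  assumes X: "X \<in> carrier_mat r m" and B: "B \<in> carrier_mat m m"
  shows "coeff_mat (X * (germ_zpow k \<cdot>\<^sub>m map_mat germ_const B)) n = coeff_mat X (n - k) * B"
proof (rule eq_matI)
  fix a b assume "a < dim_row (coeff_mat X (n - k) * B)" "b < dim_col (coeff_mat X (n - k) * B)"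
  then have ab: "a < r" "b < m" using X B by (auto simp: coeff_mat_def)
  have D: "germ_zpow k \<cdot>\<^sub>m map_mat germ_const B \<in> carrier_mat m m" using B by auto
  have "coeff_mat (X * (germ_zpow k \<cdot>\<^sub>m map_mat germ_const B)) n $$ (a, b) =
      laurent_coeff (\<Sum>l<m. X $$ (a, l) * (germ_zpow k \<cdot>\<^sub>m map_mat germ_const B) $$ (l, b)) n"
    unfolding mult_mat_index_sum[OF X D ab, symmetric]
    by (rule coeff_mat_index[OF mult_carrier_mat[OF X D] ab])
  also have "\<dots> = (\<Sum>l<m. laurent_coeff (germ_zpow k * germ_const (B $$ (l, b)) * X $$ (a, l)) n)"
    unfolding laurent_coeff_sum using B ab by (intro sum.cong refl) (simp add: mult.commute)
  also have "\<dots> = (\<Sum>l<m. coeff_mat X (n - k) $$ (a, l) * B $$ (l, b))"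
    using X ab by (intro sum.cong refl) (simp add: laurent_coeff_monomial_mult coeff_mat_index)
  also have "\<dots> = (coeff_mat X (n - k) * B) $$ (a, b)"
    by (rule mult_mat_index_sum[symmetric, of _ r m _ m]) (use X B ab in auto)
  finally show "coeff_mat (X * (germ_zpow k \<cdot>\<^sub>m map_mat germ_const B)) n $$ (a, b) =
      (coeff_mat X (n - k) * B) $$ (a, b)" .
qed (use X B in \<open>auto simp: coeff_mat_def\<close>)

lemma coeff_mat_mult_left:
  assumes A: "A \<in> carrier_mat r r" and X: "X \<in> carrier_mat r m"
  shows "coeff_mat ((germ_zpow k \<cdot>\<^sub>m map_mat germ_const A) * X) n = A * coeff_mat X (n - k)"
proof (rule eq_matI)
  fix a b assume "a < dim_row (A * coeff_mat X (n - k))" "b < dim_col (A * coeff_mat X (n - k))"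
  then have ab: "a < r" "b < m" using X A by (auto simp: coeff_mat_def)
  have D: "germ_zpow k \<cdot>\<^sub>m map_mat germ_const A \<in> carrier_mat r r" using A by auto
  have "coeff_mat ((germ_zpow k \<cdot>\<^sub>m map_mat germ_const A) * X) n $$ (a, b) =
      laurent_coeff (\<Sum>l<r. (germ_zpow k \<cdot>\<^sub>m map_mat germ_const A) $$ (a, l) * X $$ (l, b)) n"
    unfolding mult_mat_index_sum[OF D X ab, symmetric]
    by (rule coeff_mat_index[OF mult_carrier_mat[OF D X] ab])
  also have "\<dots> = (\<Sum>l<r. laurent_coeff (germ_zpow k * germ_const (A $$ (a, l)) * X $$ (l, b)) n)"
    unfolding laurent_coeff_sum using A ab by (intro sum.cong refl) simp
  also have "\<dots> = (\<Sum>l<r. A $$ (a, l) * coeff_mat X (n - k) $$ (l, b))"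
    using X ab by (intro sum.cong refl) (simp add: laurent_coeff_monomial_mult coeff_mat_index)
  also have "\<dots> = (A * coeff_mat X (n - k)) $$ (a, b)"
    by (rule mult_mat_index_sum[symmetric, of _ r r _ m]) (use X A ab in auto)
  finally show "coeff_mat ((germ_zpow k \<cdot>\<^sub>m map_mat germ_const A) * X) n $$ (a, b) =
      (A * coeff_mat X (n - k)) $$ (a, b)" .
qed (use X A in \<open>auto simp: coeff_mat_def\<close>)

lemma coeff_mat_surj:
  assumes x: "\<And>n. x n \<in> carrier_mat r m" and R: "R > 0"
    and "\<And>i. i \<in> {..<r} \<times> {..<m} \<Longrightarrow> laurent_bounded (\<lambda>n. x n $$ i) R"
  shows "\<exists>X\<in>carrier_mat r m. \<forall>n. coeff_mat X n = x n"
proof -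
  have "\<forall>i\<in>{..<r} \<times> {..<m}. \<exists>f. laurent_coeff f = (\<lambda>n. x n $$ i)"
    using laurent_coeff_surj assms by blast
  from bchoice[OF this] obtain f where f: "\<And>i. i \<in> {..<r} \<times> {..<m} \<Longrightarrow> laurent_coeff (f i) = (\<lambda>n. x n $$ i)"
    by blast
  have "coeff_mat (mat r m f) n = x n" for n
    using x[of n] f by (intro eq_matI) (auto simp: coeff_mat_def)
  then show ?thesis by (intro bexI[of _ "mat r m f"]) auto
qed

lemma laurent_bounded_mono: "laurent_bounded a R \<Longrightarrow> S \<le> R \<Longrightarrow> laurent_bounded a S"
  unfolding laurent_bounded_def by (meson less_le_trans)

lemma coeff_mat_bounded:
  assumes X: "X \<in> carrier_mat r m"
  shows "\<exists>R>0. \<forall>i\<in>{..<r} \<times> {..<m}. laurent_bounded (\<lambda>n. coeff_mat X n $$ i) R"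
proof -
  let ?I = "{..<r} \<times> {..<m}"
  have "\<forall>i\<in>?I. \<exists>R>0. laurent_bounded (laurent_coeff (X $$ i)) R"
    using laurent_coeff_bounded by blast
  from bchoice[OF this] obtain Rf
    where Rf0: "\<forall>i\<in>?I. Rf i > 0 \<and> laurent_bounded (laurent_coeff (X $$ i)) (Rf i)" ..
  have Rf: "Rf i > 0 \<and> laurent_bounded (laurent_coeff (X $$ i)) (Rf i)" if "i \<in> ?I" for i
    by (rule Rf0[rule_format, OF that])
  define R where "R = Min (insert 1 (Rf ` ?I))"
  have "R > 0" unfolding R_def using Rf by (subst Min_gr_iff) auto
  moreover have "laurent_bounded (\<lambda>n. coeff_mat X n $$ i) R" if i: "i \<in> ?I" for i
  proof -
    have "R \<le> Rf i" unfolding R_def using i by (intro Min_le) auto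
    then have "laurent_bounded (laurent_coeff (X $$ i)) R"
      using Rf[OF i] laurent_bounded_mono by blast
    moreover have "(\<lambda>n. coeff_mat X n $$ i) = laurent_coeff (X $$ i)"
      using i X by (auto simp: coeff_mat_def)
    ultimately show ?thesis by simp
  qed
  ultimately show ?thesis by blast
qed

text \<open>
  Membership in the space of normal forms becomes a vanishing condition on Laurent coefficients.
\<close>

lemma germ_laurent_polynomial_iff:
  "(\<exists>c. f = (\<Sum>l\<in>{\<nu>..<\<mu>}. germ_const (c l) * germ_zpow l)) \<longleftrightarrow>
   (\<forall>n. n < \<nu> \<or> \<mu> \<le> n \<longrightarrow> laurent_coeff f n = 0)"
proof -
  have monomial: "laurent_coeff (germ_const c * germ_zpow l) n = (if n = l then c else 0)" for c l n
    using laurent_coeff_zpow_mult[of l "germ_const c" n] by (simp add: mult.commute laurent_coeff_const)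
  have polynomial: "laurent_coeff (\<Sum>l\<in>{\<nu>..<\<mu>}. germ_const (c l) * germ_zpow l) n =
      (if n \<in> {\<nu>..<\<mu>} then c n else 0)" for c n
    unfolding laurent_coeff_sum monomial by simp
  show ?thesis
  proof
    assume "\<forall>n. n < \<nu> \<or> \<mu> \<le> n \<longrightarrow> laurent_coeff f n = 0"
    then have "f = (\<Sum>l\<in>{\<nu>..<\<mu>}. germ_const (laurent_coeff f l) * germ_zpow l)"
      by (intro germ_eqI) (auto simp: polynomial)
    then show "\<exists>c. f = (\<Sum>l\<in>{\<nu>..<\<mu>}. germ_const (c l) * germ_zpow l)" by blast
  qed (auto simp: polynomial)
qed

lemma normal_form_space_iff:
  "Y \<in> normal_form_space r m \<mu> \<nu> \<longleftrightarrow>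
    Y \<in> carrier_mat r m \<and> (\<forall>n. n < \<nu> \<or> \<mu> \<le> n \<longrightarrow> coeff_mat Y n = 0\<^sub>m r m)"
proof (cases "Y \<in> carrier_mat r m")
  case True
  have "coeff_mat Y n = 0\<^sub>m r m \<longleftrightarrow> (\<forall>a<r. \<forall>b<m. laurent_coeff (Y $$ (a, b)) n = 0)" for n
    using True by (auto simp: mat_eq_iff coeff_mat_def)
  then show ?thesis
    using True unfolding normal_form_space_def germ_laurent_polynomial_iff by blast
qed (simp add: normal_form_space_def)

lemma smult_add_diff_cancel_mat:
  fixes c :: "'a :: comm_ring"
  assumes "P \<in> carrier_mat n m" "Q \<in> carrier_mat n m" "S \<in> carrier_mat n m"
  shows "(c \<cdot>\<^sub>m P + S) - (c \<cdot>\<^sub>m Q + S) = c \<cdot>\<^sub>m (P - Q)"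
  using assms by (intro eq_matI) (auto simp: right_diff_distrib)

text \<open>
  The equations for the coefficients outside the window \<open>\<nu> \<le> n < \<mu>\<close> determine \<open>X\<close> by the recurrence; then \<open>Y\<close> is the
  difference of the two sides, which lies in the window by construction.
\<close>

lemma two_block_normal_form:
  fixes q :: complex
  assumes q: "norm q > 1" and \<nu>\<mu>: "\<nu> < \<mu>"
    and A: "A \<in> carrier_mat r r" "invertible_mat A" and B: "B \<in> carrier_mat m m" "invertible_mat B"
    and W: "W \<in> carrier_mat r m"
  shows "\<exists>!(X, Y). X \<in> carrier_mat r m \<and> Y \<in> normal_form_space r m \<mu> \<nu> \<and>
    map_mat (sigma q) X * (germ_zpow (- \<nu>) \<cdot>\<^sub>m map_mat germ_const B) + W =
    (germ_zpow (- \<mu>) \<cdot>\<^sub>m map_mat germ_const A) * X + Y"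
proof -
  have inverse: "\<exists>M'. M' \<in> carrier_mat n n \<and> M * M' = 1\<^sub>m n \<and> M' * M = 1\<^sub>m n"
    if "M \<in> carrier_mat n n" "invertible_mat M" for M :: "complex mat" and n
  proof -
    from that(2) obtain M' where M': "inverts_mat M M'" "inverts_mat M' M"
      by (auto simp: invertible_mat_def)
    have "dim_row M' = n" "dim_col M' = n"
      using M' that(1) index_mult_mat(2,3)[of M M'] index_mult_mat(2,3)[of M' M]
        index_one_mat(2,3)
      by (auto simp: inverts_mat_def)
    then show ?thesis using M' that(1) by (intro exI[of _ M']) (auto simp: inverts_mat_def)
  qed
  from inverse[OF A] obtain A' where A': "A' \<in> carrier_mat r r" "A * A' = 1\<^sub>m r" "A' * A = 1\<^sub>m r"
    by blast
  from inverse[OF B] obtain B' where B': "B' \<in> carrier_mat m m" "B * B' = 1\<^sub>m m" "B' * B = 1\<^sub>m m"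
    by blast
  note AA = A(1) A' and BB = B(1) B'
  have q0: "q \<noteq> 0" using q by auto
  define L where "L = (\<lambda>X. map_mat (sigma q) X * (germ_zpow (- \<nu>) \<cdot>\<^sub>m map_mat germ_const B) + W)"
  define M where "M = (\<lambda>X. (germ_zpow (- \<mu>) \<cdot>\<^sub>m map_mat germ_const A) * X)"
  have LM: "L X \<in> carrier_mat r m" "M X \<in> carrier_mat r m" if "X \<in> carrier_mat r m" for X
    using that A(1) B(1) W unfolding L_def M_def by auto
  have cL: "coeff_mat (L X) n = q powi (n + \<nu>) \<cdot>\<^sub>m (coeff_mat X (n + \<nu>) * B) + coeff_mat W n"
    and cM: "coeff_mat (M X) n = A * coeff_mat X (n + \<mu>)"
    if X: "X \<in> carrier_mat r m" for X n
  proof -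
    have sX: "map_mat (sigma q) X \<in> carrier_mat r m" using X by auto
    have "map_mat (sigma q) X * (germ_zpow (- \<nu>) \<cdot>\<^sub>m map_mat germ_const B) \<in> carrier_mat r m"
      using X B(1) by auto
    then have "coeff_mat (L X) n = (q powi (n + \<nu>) \<cdot>\<^sub>m coeff_mat X (n + \<nu>)) * B + coeff_mat W n"
      unfolding L_def by (simp add: coeff_mat_add[OF _ W] coeff_mat_mult_right[OF sX B(1)] coeff_mat_sigma[OF q0])
    then show "coeff_mat (L X) n = q powi (n + \<nu>) \<cdot>\<^sub>m (coeff_mat X (n + \<nu>) * B) + coeff_mat W n"
      using X B(1) by (simp add: mult_smult_assoc_mat[of _ r m _ m])
    show "coeff_mat (M X) n = A * coeff_mat X (n + \<mu>)"
      unfolding M_def by (simp add: coeff_mat_mult_left[OF A(1) X])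
  qed
  have cW: "coeff_mat W n \<in> carrier_mat r m" for n using W by simp
  have eq_iff: "L X = M X + Y \<longleftrightarrow> Y = L X - M X"
    if "X \<in> carrier_mat r m" "Y \<in> carrier_mat r m" for X Y
    using LM[OF that(1)] that(2) by (auto simp: mat_eq_iff)
  \<comment> \<open>This eliminates \<open>Y\<close>: only the recurrence for \<open>X\<close> remains.\<close>
  have rec_iff: "L X - M X \<in> normal_form_space r m \<mu> \<nu> \<longleftrightarrow>
      coeff_recurrence q \<mu> \<nu> A B (coeff_mat W) (coeff_mat X)"
    if X: "X \<in> carrier_mat r m" for X
  proof -
    have LX: "coeff_mat (L X) n \<in> carrier_mat r m" "coeff_mat (M X) n \<in> carrier_mat r m" for n
      using LM[OF X] by auto
    have "coeff_mat (L X - M X) n = 0\<^sub>m r m \<longleftrightarrow> coeff_mat (L X) n = coeff_mat (M X) n" for n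
      unfolding coeff_mat_minus[OF LM[OF X]] using LX[of n] by (auto simp: mat_eq_iff)
    moreover have "L X - M X \<in> carrier_mat r m" using LM[OF X] by auto
    ultimately show ?thesis
      unfolding normal_form_space_iff coeff_recurrence_def cL[OF X] cM[OF X] by simp
  qed
  obtain R where R: "R > 0" and R': "\<forall>i\<in>{..<r} \<times> {..<m}. laurent_bounded (\<lambda>n. coeff_mat W n $$ i) R"
    using coeff_mat_bounded[OF W] by blast
  have "laurent_bounded (\<lambda>n. coeff_mat W n $$ i) R" if "i \<in> {..<r} \<times> {..<m}" for i
    by (rule R'[rule_format, OF that])
  from coeff_recurrence_solution[OF q \<nu>\<mu> AA BB cW R this]
  obtain x where x0: "(\<forall>n. x n \<in> carrier_mat r m) \<and> coeff_recurrence q \<mu> \<nu> A B (coeff_mat W) x \<and>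
    (\<forall>i\<in>{..<r} \<times> {..<m}. laurent_bounded (\<lambda>n. x n $$ i) R)" by (rule exE)
  have x: "x n \<in> carrier_mat r m" for n using x0 by blast
  have xb: "laurent_bounded (\<lambda>n. x n $$ i) R" if "i \<in> {..<r} \<times> {..<m}" for i
    using x0 that by blast
  from coeff_mat_surj[OF x R xb]
  obtain X where X: "X \<in> carrier_mat r m" "\<forall>n. coeff_mat X n = x n" by blast
  have "coeff_mat X = x" using X(2) by blast
  with x0 rec_iff[OF X(1)] have nf: "L X - M X \<in> normal_form_space r m \<mu> \<nu>" by simp
  have unique: "X1 = X2"
    if X1: "X1 \<in> carrier_mat r m" "L X1 - M X1 \<in> normal_form_space r m \<mu> \<nu>"
      and X2: "X2 \<in> carrier_mat r m" "L X2 - M X2 \<in> normal_form_space r m \<mu> \<nu>" for X1 X2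
  proof -
    have D: "X1 - X2 \<in> carrier_mat r m" using X1 X2 by auto
    have c1: "coeff_mat X1 n \<in> carrier_mat r m" and c2: "coeff_mat X2 n \<in> carrier_mat r m" for n
      using X1 X2 by auto
    have "coeff_recurrence q \<mu> \<nu> A B (\<lambda>_. 0\<^sub>m r m) (coeff_mat (X1 - X2))"
      unfolding coeff_recurrence_def
    proof (intro allI impI)
      fix n assume n: "n < \<nu> \<or> \<mu> \<le> n"
      let ?c = "q powi (n + \<nu>)"
      have e1: "?c \<cdot>\<^sub>m (coeff_mat X1 (n + \<nu>) * B) + coeff_mat W n = A * coeff_mat X1 (n + \<mu>)"
        and e2: "?c \<cdot>\<^sub>m (coeff_mat X2 (n + \<nu>) * B) + coeff_mat W n = A * coeff_mat X2 (n + \<mu>)"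
        using X1 X2 n rec_iff unfolding coeff_recurrence_def by blast+
      have "A * coeff_mat (X1 - X2) (n + \<mu>) = A * coeff_mat X1 (n + \<mu>) - A * coeff_mat X2 (n + \<mu>)"
        unfolding coeff_mat_minus[OF X1(1) X2(1)] by (rule mult_minus_distrib_mat[OF A(1) c1 c2])
      also have "\<dots> = ?c \<cdot>\<^sub>m (coeff_mat X1 (n + \<nu>) * B - coeff_mat X2 (n + \<nu>) * B)"
        unfolding e1[symmetric] e2[symmetric]
        by (rule smult_add_diff_cancel_mat[OF mult_carrier_mat[OF c1 B(1)] mult_carrier_mat[OF c2 B(1)] cW])
      also have "\<dots> = ?c \<cdot>\<^sub>m (coeff_mat (X1 - X2) (n + \<nu>) * B)"
        unfolding coeff_mat_minus[OF X1(1) X2(1)] minus_mult_distrib_mat[OF c1 c2 B(1)] ..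
      also have "\<dots> = ?c \<cdot>\<^sub>m (coeff_mat (X1 - X2) (n + \<nu>) * B) + 0\<^sub>m r m"
        using mult_carrier_mat[OF _ B(1), of "coeff_mat (X1 - X2) (n + \<nu>)" r] D by (intro right_add_zero_mat[symmetric]) auto
      finally show "?c \<cdot>\<^sub>m (coeff_mat (X1 - X2) (n + \<nu>) * B) + 0\<^sub>m r m = A * coeff_mat (X1 - X2) (n + \<mu>)" ..
    qed
    note rec = this
    obtain S where S: "S > 0"
      "\<forall>i\<in>{..<r} \<times> {..<m}. laurent_bounded (\<lambda>n. coeff_mat (X1 - X2) n $$ i) S"
      using coeff_mat_bounded[OF D] by blast
    have "coeff_mat (X1 - X2) n = 0\<^sub>m r m" for n
      by (rule coeff_recurrence_homogeneous_eq_0[OF q \<nu>\<mu> AA BB _ rec S(1)]) (use S(2) D in auto)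
    then have "coeff_mat X1 n = coeff_mat X2 n" for n
      unfolding coeff_mat_minus[OF X1(1) X2(1)] using c1[of n] c2[of n] by (auto simp: mat_eq_iff)
    then show ?thesis by (rule coeff_mat_eqI[OF X1(1) X2(1)])
  qed
  have "\<exists>!(X, Y). X \<in> carrier_mat r m \<and> Y \<in> normal_form_space r m \<mu> \<nu> \<and> L X = M X + Y"
  proof (intro ex1I[of _ "(X, L X - M X)"], goal_cases)
    case 1
    show ?case using X(1) nf eq_iff[OF X(1)] nf[unfolded normal_form_space_iff] by simp
  next
    case (2 XY)
    obtain X2 Y2 where XY: "XY = (X2, Y2)" by (cases XY)
    with 2 have h: "X2 \<in> carrier_mat r m" "Y2 \<in> normal_form_space r m \<mu> \<nu>" "L X2 = M X2 + Y2" by auto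
    have "Y2 \<in> carrier_mat r m" using h(2) by (simp add: normal_form_space_def)
    with h have Y2: "Y2 = L X2 - M X2" using eq_iff by blast
    with unique[OF h(1) _ X(1) nf] h(2) have "X2 = X" by simp
    with Y2 XY show ?case by simp
  qed
  then show ?thesis unfolding L_def M_def .
qed

section \<open>Block triangular matrices and the gauge equation\<close>

text \<open>
  Together with \<open>block_of_pos\<close>, this says that a row index amounts to a block number \<open>l\<close> and a
  position \<open>p < r l\<close> in the block.
\<close>

lemma block_of_offset:
  assumes l: "l \<ge> 1" and p: "p < r l"
  shows "block_of r ((\<Sum>i=1..<l. r i) + p) = l" and "block_pos r ((\<Sum>i=1..<l. r i) + p) = p"
proof -
  let ?a = "(\<Sum>i=1..<l. r i) + p"
  show b: "block_of r ?a = l"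
    unfolding block_of_def
  proof (rule Least_equality)
    have "{1..l} = insert l {1..<l}" using l by auto
    then show "?a < (\<Sum>i=1..l. r i)" using p by simp
  next
    fix i assume i: "?a < (\<Sum>i=1..i. r i)"
    show "l \<le> i"
    proof (rule ccontr)
      assume "\<not> l \<le> i"
      then have "(\<Sum>i=1..i. r i) \<le> (\<Sum>i=1..<l. r i)" by (intro sum_mono2) auto
      with i show False by simp
    qed
  qed
  show "block_pos r ?a = p" unfolding block_pos_def b by simp
qed

lemma block_of_pos:
  assumes a: "a < (\<Sum>l=1..k. r l)"
  shows "1 \<le> block_of r a" "block_of r a \<le> k" "block_pos r a < r (block_of r a)"
    and "(\<Sum>i=1..<block_of r a. r i) + block_pos r a = a"
proof -
  let ?i = "block_of r a"
  have lt: "a < (\<Sum>l=1..?i. r l)" unfolding block_of_def by (rule LeastI[of _ k]) (rule a)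
  show "?i \<le> k" unfolding block_of_def by (rule Least_le) (rule a)
  show i1: "1 \<le> ?i" using lt by (cases "?i = 0") auto
  have "\<not> a < (\<Sum>l=1..?i - 1. r l)"
    using i1 not_less_Least[of "?i - 1" "\<lambda>i. a < (\<Sum>l=1..i. r l)"] by (simp add: block_of_def)
  moreover have "{1..?i - 1} = {1..<?i}" using i1 by auto
  ultimately have le: "(\<Sum>l=1..<?i. r l) \<le> a" by simp
  then show "(\<Sum>i=1..<?i. r i) + block_pos r a = a" by (simp add: block_pos_def)
  have "{1..?i} = insert ?i {1..<?i}" using i1 by auto
  with lt have "a < r ?i + (\<Sum>l=1..<?i. r l)" by simp
  with le show "block_pos r a < r ?i" by (simp add: block_pos_def)
qed

lemma block_of_mono:
  assumes "a \<le> b" "b < (\<Sum>l=1..k. r l)"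
  shows "block_of r a \<le> block_of r b"
proof -
  have "b < (\<Sum>l=1..block_of r b. r l)" unfolding block_of_def by (rule LeastI[of _ k]) (rule assms)
  with assms(1) have "a < (\<Sum>l=1..block_of r b. r l)" by simp
  then show ?thesis unfolding block_of_def[of r a] by (rule Least_le)
qed

lemma sum_over_blocks:
  fixes h :: "nat \<Rightarrow> nat \<Rightarrow> 'a :: comm_monoid_add"
  shows "(\<Sum>c<(\<Sum>l=1..k. r l). h (block_of r c) (block_pos r c)) = (\<Sum>l=1..k. \<Sum>p<r l. h l p)"
proof (induction k)
  case (Suc k)
  let ?N = "\<Sum>l=1..k. r l"
  have N: "(\<Sum>l=1..Suc k. r l) = ?N + r (Suc k)" by simp
  have split: "(\<Sum>c<m + n. g c) = (\<Sum>c<m. g c) + (\<Sum>p<n. g (m + p))" for g :: "nat \<Rightarrow> 'a" and m n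
    by (induction n) (simp_all add: add.assoc)
  have "(\<Sum>c<?N + r (Suc k). h (block_of r c) (block_pos r c)) =
      (\<Sum>c<?N. h (block_of r c) (block_pos r c)) + (\<Sum>p<r (Suc k). h (block_of r (?N + p)) (block_pos r (?N + p)))"
    by (rule split)
  also have "(\<Sum>p<r (Suc k). h (block_of r (?N + p)) (block_pos r (?N + p))) = (\<Sum>p<r (Suc k). h (Suc k) p)"
  proof (intro sum.cong refl)
    fix p assume "p \<in> {..<r (Suc k)}"
    moreover have "{1..<Suc k} = {1..k}" by auto
    ultimately show "h (block_of r (?N + p)) (block_pos r (?N + p)) = h (Suc k) p"
      using block_of_offset[of "Suc k" p r] by simp
  qed
  finally show ?case unfolding N Suc.IH by simp
qed simp

lemma block_mat_carrier [simp]: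
  "block_mat r k B \<in> carrier_mat (\<Sum>l=1..k. r l) (\<Sum>l=1..k. r l)"
  by (simp add: block_mat_def)

lemma block_mat_index:
  "a < (\<Sum>l=1..k. r l) \<Longrightarrow> b < (\<Sum>l=1..k. r l) \<Longrightarrow>
   block_mat r k B $$ (a, b) = B (block_of r a) (block_of r b) $$ (block_pos r a, block_pos r b)"
  by (simp add: block_mat_def)

lemma block_mat_mult_index:
  fixes B C :: "nat \<Rightarrow> nat \<Rightarrow> 'a :: semiring_0 mat"
  assumes B: "\<And>i j. i \<in> {1..k} \<Longrightarrow> j \<in> {1..k} \<Longrightarrow> B i j \<in> carrier_mat (r i) (r j)"
    and C: "\<And>i j. i \<in> {1..k} \<Longrightarrow> j \<in> {1..k} \<Longrightarrow> C i j \<in> carrier_mat (r i) (r j)"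
    and ab: "a < (\<Sum>l=1..k. r l)" "b < (\<Sum>l=1..k. r l)"
  shows "(block_mat r k B * block_mat r k C) $$ (a, b) =
    (\<Sum>l=1..k. (B (block_of r a) l * C l (block_of r b)) $$ (block_pos r a, block_pos r b))"
proof -
  let ?i = "block_of r a" and ?j = "block_of r b"
  have ij: "?i \<in> {1..k}" "?j \<in> {1..k}" using block_of_pos[OF ab(1)] block_of_pos[OF ab(2)] by auto
  have "(block_mat r k B * block_mat r k C) $$ (a, b) =
      (\<Sum>c<(\<Sum>l=1..k. r l). block_mat r k B $$ (a, c) * block_mat r k C $$ (c, b))"
    by (rule mult_mat_index_sum[OF block_mat_carrier block_mat_carrier ab])
  also have "\<dots> = (\<Sum>c<(\<Sum>l=1..k. r l). B ?i (block_of r c) $$ (block_pos r a, block_pos r c) *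
      C (block_of r c) ?j $$ (block_pos r c, block_pos r b))"
    using ab by (intro sum.cong refl) (simp add: block_mat_index)
  also have "\<dots> = (\<Sum>l=1..k. \<Sum>p<r l. B ?i l $$ (block_pos r a, p) * C l ?j $$ (p, block_pos r b))"
    by (rule sum_over_blocks[where h = "\<lambda>l p. B ?i l $$ (block_pos r a, p) * C l ?j $$ (p, block_pos r b)"])
  also have "\<dots> = (\<Sum>l=1..k. (B ?i l * C l ?j) $$ (block_pos r a, block_pos r b))"
  proof (rule sum.cong[OF refl])
    fix l assume l: "l \<in> {1..k}"
    show "(\<Sum>p<r l. B ?i l $$ (block_pos r a, p) * C l ?j $$ (p, block_pos r b)) =
        (B ?i l * C l ?j) $$ (block_pos r a, block_pos r b)"
      using block_of_pos[OF ab(1)] block_of_pos[OF ab(2)]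
      by (intro mult_mat_index_sum[OF B[OF ij(1) l] C[OF l ij(2)], symmetric])
  qed
  finally show ?thesis .
qed

lemma block_mat_mult_eq_iff:
  fixes B C B' C' :: "nat \<Rightarrow> nat \<Rightarrow> 'a :: semiring_0 mat"
  assumes B: "\<And>i j. i \<in> {1..k} \<Longrightarrow> j \<in> {1..k} \<Longrightarrow> B i j \<in> carrier_mat (r i) (r j)"
    and C: "\<And>i j. i \<in> {1..k} \<Longrightarrow> j \<in> {1..k} \<Longrightarrow> C i j \<in> carrier_mat (r i) (r j)"
    and B': "\<And>i j. i \<in> {1..k} \<Longrightarrow> j \<in> {1..k} \<Longrightarrow> B' i j \<in> carrier_mat (r i) (r j)"
    and C': "\<And>i j. i \<in> {1..k} \<Longrightarrow> j \<in> {1..k} \<Longrightarrow> C' i j \<in> carrier_mat (r i) (r j)"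
  shows "block_mat r k B * block_mat r k C = block_mat r k B' * block_mat r k C' \<longleftrightarrow>
    (\<forall>i\<in>{1..k}. \<forall>j\<in>{1..k}. \<forall>a<r i. \<forall>b<r j.
       (\<Sum>l=1..k. (B i l * C l j) $$ (a, b)) = (\<Sum>l=1..k. (B' i l * C' l j) $$ (a, b)))"
    (is "?L = ?R \<longleftrightarrow> ?blocks")
proof -
  have L: "?L $$ (a, b) = (\<Sum>l=1..k. (B (block_of r a) l * C l (block_of r b)) $$ (block_pos r a, block_pos r b))"
    if "a < (\<Sum>l=1..k. r l)" "b < (\<Sum>l=1..k. r l)" for a b
    by (rule block_mat_mult_index) (use B C that in auto)
  have R: "?R $$ (a, b) = (\<Sum>l=1..k. (B' (block_of r a) l * C' l (block_of r b)) $$ (block_pos r a, block_pos r b))"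
    if "a < (\<Sum>l=1..k. r l)" "b < (\<Sum>l=1..k. r l)" for a b
    by (rule block_mat_mult_index) (use B' C' that in auto)
  show ?thesis
  proof
    assume eq: "?L = ?R"
    show ?blocks
    proof (intro ballI allI impI)
      fix i j a b assume ij: "i \<in> {1..k}" "j \<in> {1..k}" and a: "a < r i" and b: "b < r j"
      have lt: "(\<Sum>l=1..<i. r l) + a < (\<Sum>l=1..k. r l)" if "i \<in> {1..k}" "a < r i" for i a
      proof -
        have "(\<Sum>l=1..<i. r l) + r i = (\<Sum>l\<in>insert i {1..<i}. r l)" by simp
        also have "\<dots> \<le> (\<Sum>l=1..k. r l)" using that by (intro sum_mono2) auto
        finally show ?thesis using that by simp
      qed
      show "(\<Sum>l=1..k. (B i l * C l j) $$ (a, b)) = (\<Sum>l=1..k. (B' i l * C' l j) $$ (a, b))"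
        using L[OF lt[OF ij(1) a] lt[OF ij(2) b]] R[OF lt[OF ij(1) a] lt[OF ij(2) b]]
          eq block_of_offset[of i a r, OF _ a] block_of_offset[of j b r, OF _ b] ij
        by simp
    qed
  next
    assume blocks: ?blocks
    show "?L = ?R"
    proof (rule eq_matI)
      fix a b assume "a < dim_row ?R" "b < dim_col ?R"
      then have ab: "a < (\<Sum>l=1..k. r l)" "b < (\<Sum>l=1..k. r l)" by (simp_all add: block_mat_def)
      show "?L $$ (a, b) = ?R $$ (a, b)"
        unfolding L[OF ab] R[OF ab]
        using blocks block_of_pos[OF ab(1)] block_of_pos[OF ab(2)] by simp
    qed (simp_all add: block_mat_def)
  qed
qed

text \<open>
  In the sum for a block of the product only \<open>i \<le> l \<le> j\<close> contribute; the extreme terms are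
  split off because they contain the diagonal blocks.
\<close>

lemma upper_triangular_block_product:
  fixes P Q :: "nat \<Rightarrow> nat \<Rightarrow> 'a :: semiring_0 mat"
  assumes P: "\<And>i j. i \<in> {1..k} \<Longrightarrow> j \<in> {1..k} \<Longrightarrow> P i j \<in> carrier_mat (r i) (r j)"
    and Q: "\<And>i j. i \<in> {1..k} \<Longrightarrow> j \<in> {1..k} \<Longrightarrow> Q i j \<in> carrier_mat (r i) (r j)"
    and P0: "\<And>i j. j < i \<Longrightarrow> P i j = 0\<^sub>m (r i) (r j)" and Q0: "\<And>i j. j < i \<Longrightarrow> Q i j = 0\<^sub>m (r i) (r j)"
    and ij: "i \<in> {1..k}" "j \<in> {1..k}" and a: "a < r i" and b: "b < r j"
  shows "(\<Sum>l=1..k. (P i l * Q l j) $$ (a, b)) =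
    (if j < i then 0 else if i = j then (P i i * Q i i) $$ (a, b)
     else (P i i * Q i j) $$ (a, b) + (P i j * Q j j) $$ (a, b) + (\<Sum>l\<in>{i<..<j}. (P i l * Q l j) $$ (a, b)))"
proof -
  have z: "(P i l * Q l j) $$ (a, b) = 0" if l: "l \<in> {1..k}" and "l < i \<or> j < l" for l
  proof (cases "l < i")
    case True
    then show ?thesis using Q[OF l ij(2)] a b by (simp add: P0)
  next
    case False
    with that have "j < l" by auto
    then show ?thesis using P[OF ij(1) l] a b by (simp add: Q0)
  qed
  have "(\<Sum>l=1..k. (P i l * Q l j) $$ (a, b)) = (\<Sum>l\<in>{i..j}. (P i l * Q l j) $$ (a, b))"
    by (rule sum.mono_neutral_right) (use z ij in auto)
  also have "\<dots> = (if j < i then 0 else if i = j then (P i i * Q i i) $$ (a, b)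
     else (P i i * Q i j) $$ (a, b) + (P i j * Q j j) $$ (a, b) + (\<Sum>l\<in>{i<..<j}. (P i l * Q l j) $$ (a, b)))"
  proof (cases i j rule: linorder_cases)
    case less
    then have "{i..j} = insert i (insert j {i<..<j})" by auto
    with less show ?thesis by (simp add: add.assoc)
  qed auto
  finally show ?thesis .
qed

lemma unipotent_mat_in_group:
  "unipotent_mat r k F \<in> unipotent_group r k"
proof -
  have "a = b" if ab: "a < (\<Sum>l=1..k. r l)" "b < (\<Sum>l=1..k. r l)"
    and "block_of r a = block_of r b" "block_pos r a = block_pos r b" for a b
    using block_of_pos(4)[OF ab(1)] block_of_pos(4)[OF ab(2)] that by simp
  note inj = this
  show ?thesis
    unfolding unipotent_group_def unipotent_mat_def upper_block_mat_def
  proof (intro CollectI conjI allI impI block_mat_carrier)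
    fix a b assume ab: "a < (\<Sum>l=1..k. r l)" "b < (\<Sum>l=1..k. r l)"
    note pos = block_of_pos(3)[OF ab(1)] block_of_pos(3)[OF ab(2)]
    let ?M = "block_mat r k (\<lambda>i j. if i = j then 1\<^sub>m (r i) else if i < j then F (i, j) else 0\<^sub>m (r i) (r j))"
    show "?M $$ (a, b) = 0" if "block_of r b < block_of r a"
      unfolding block_mat_index[OF ab] using that pos by simp
    show "?M $$ (a, b) = (if a = b then 1 else 0)" if "block_of r a = block_of r b"
      unfolding block_mat_index[OF ab] using that pos inj[OF ab that] by auto
  qed
qed

text \<open>
  Such a matrix is upper triangular in the usual sense, block numbers being monotone, and has ones
  on the diagonal; so its determinant is \<open>1\<close> and its adjugate is an inverse over any commutative ring.
\<close>

lemma unipotent_group_invertible: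
  fixes F :: "'a :: comm_ring_1 mat"
  assumes F: "F \<in> unipotent_group r k"
  shows "\<exists>G\<in>carrier_mat (\<Sum>l=1..k. r l) (\<Sum>l=1..k. r l).
    F * G = 1\<^sub>m (\<Sum>l=1..k. r l) \<and> G * F = 1\<^sub>m (\<Sum>l=1..k. r l)"
proof -
  let ?N = "\<Sum>l=1..k. r l"
  have C: "F \<in> carrier_mat ?N ?N" using F by (simp add: unipotent_group_def)
  have entries: "block_of r b < block_of r a \<longrightarrow> F $$ (a, b) = 0"
    "block_of r a = block_of r b \<longrightarrow> F $$ (a, b) = (if a = b then 1 else 0)" if "a < ?N" "b < ?N" for a b
    using F that by (auto simp: unipotent_group_def)
  have "upper_triangular F"
  proof (rule upper_triangularI)
    fix a b assume ba: "b < a" and "a < dim_row F"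
    with C have a: "a < ?N" by simp
    with ba have "block_of r b \<le> block_of r a" by (intro block_of_mono) auto
    then show "F $$ (a, b) = 0" using entries[of a b] a ba by (cases "block_of r b = block_of r a") auto
  qed
  then have "Determinant.det F = prod_list (diag_mat F)" by (rule det_upper_triangular[OF _ C])
  also have "diag_mat F = map (\<lambda>_. 1) [0..<?N]"
    using C entries by (auto simp: diag_mat_def)
  also have "prod_list (map (\<lambda>_. 1 :: 'a) [0..<?N]) = 1"
    by (simp add: map_replicate_const)
  finally have "Determinant.det F = 1" .
  then show ?thesis using adj_mat[OF C] by (intro bexI[of _ "adj_mat F"]) auto
qed

lemma gauge_transform_eq_iff:
  assumes F: "F \<in> unipotent_group r k"
    and A: "A \<in> carrier_mat (\<Sum>l=1..k. r l) (\<Sum>l=1..k. r l)" and B: "B \<in> carrier_mat (\<Sum>l=1..k. r l) (\<Sum>l=1..k. r l)"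
  shows "gauge_transform q F A = B \<longleftrightarrow> map_mat (sigma q) F * A = B * F"
proof -
  let ?N = "\<Sum>l=1..k. r l"
  have C: "F \<in> carrier_mat ?N ?N" using F by (simp add: unipotent_group_def)
  from unipotent_group_invertible[OF F] obtain G
    where G: "G \<in> carrier_mat ?N ?N" "F * G = 1\<^sub>m ?N" "G * F = 1\<^sub>m ?N" by blast
  interpret ring "ring_mat TYPE(germ) ?N ()" by (rule ring_mat)
  have "inv\<^bsub>ring_mat TYPE(germ) ?N ()\<^esub> F = G"
    by (rule inv_unique'[symmetric]) (use G C in \<open>auto simp: ring_mat_simps\<close>)
  then have gt: "gauge_transform q F A = map_mat (sigma q) F * A * G"
    using C by (simp add: gauge_transform_def)
  have SA: "map_mat (sigma q) F * A \<in> carrier_mat ?N ?N" using C A by auto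
  have XGF: "X * G * F = X" and XFG: "X * F * G = X" if "X \<in> carrier_mat ?N ?N" for X
    using assoc_mult_mat[OF that G(1) C] assoc_mult_mat[OF that C G(1)] G(2,3) right_mult_one_mat[OF that]
    by simp_all
  show ?thesis unfolding gt
  proof
    assume "map_mat (sigma q) F * A * G = B"
    then show "map_mat (sigma q) F * A = B * F" using XGF[OF SA] by simp
  next
    assume "map_mat (sigma q) F * A = B * F"
    then show "map_mat (sigma q) F * A * G = B" using XFG[OF B] by simp
  qed
qed

section \<open>Existence and uniqueness of the normal form\<close>

text \<open>
  Well-founded recursion with a relation in place of a recursion function: \<open>P f x s\<close> means that \<open>s\<close> is the
  right value at \<open>x\<close>, given those that \<open>f\<close> takes at smaller arguments.
\<close>

lemma ex1_wf_recursive_family: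
  assumes wf: "wf R"
    and adm: "\<And>f g x s. (\<And>y. (y, x) \<in> R \<Longrightarrow> f y = g y) \<Longrightarrow> P f x s = P g x s"
    and ex1: "\<And>f x. \<exists>!s. P f x s"
  shows "\<exists>!f. \<forall>x. P f x (f x)"
proof (rule ex_ex1I)
  show "\<exists>f. \<forall>x. P f x (f x)"
    by (rule dependent_wf_choice[OF wf adm]) (use ex1 in blast)+
next
  fix f g assume f: "\<forall>x. P f x (f x)" and g: "\<forall>x. P g x (g x)"
  have "f x = g x" for x
    using wf
  proof (induction x rule: wf_induct_rule)
    case (less x)
    have "P g x (f x)" using adm[of x f g "f x"] less f by simp
    with g ex1[of g x] show ?case by blast
  qed
  then show "f = g" by auto
qed

lemma sigma_0 [simp]: "sigma q 0 = 0" and sigma_1 [simp]: "sigma q 1 = 1"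
  by (transfer; auto simp: germ_rel_def intro!: singularity_intros)+

text \<open>
  The part of the \<open>(i, j)\<close> block of \<open>(\<sigma>\<^sub>q F) A\<^sub>U - A\<^sub>V F\<close> that contains neither \<open>F\<^sub>i\<^sub>j\<close> nor
  \<open>V\<^sub>i\<^sub>j\<close>. The argument \<open>f\<close> is the family of pairs \<open>(F, V)\<close>, the form in which the recursion
  delivers it.
\<close>

definition inhomogeneity :: "complex \<Rightarrow> (nat \<Rightarrow> nat) \<Rightarrow> (nat \<times> nat \<Rightarrow> germ mat) \<Rightarrow>
    (nat \<times> nat \<Rightarrow> germ mat \<times> germ mat) \<Rightarrow> nat \<times> nat \<Rightarrow> germ mat" where
  "inhomogeneity q r U f = (\<lambda>(i, j). mat (r i) (r j) (\<lambda>e. U (i, j) $$ e +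
     (\<Sum>l\<in>{i<..<j}. (map_mat (sigma q) (fst (f (i, l))) * U (l, j)) $$ e -
        (snd (f (i, l)) * fst (f (l, j))) $$ e)))"

lemma inhomogeneity_carrier [simp]:
  "inhomogeneity q r U f (i, j) \<in> carrier_mat (r i) (r j)"
  by (simp add: inhomogeneity_def)

lemma gauge_equation_iff_blocks:
  fixes q :: complex and A :: "nat \<Rightarrow> complex mat"
  assumes A: "\<And>i. i \<in> {1..k} \<Longrightarrow> A i \<in> carrier_mat (r i) (r i)"
    and U: "\<And>i j. (i, j) \<in> upper_pairs k \<Longrightarrow> U (i, j) \<in> carrier_mat (r i) (r j)"
    and F: "\<And>i j. (i, j) \<in> upper_pairs k \<Longrightarrow> F (i, j) \<in> carrier_mat (r i) (r j)"
    and V: "\<And>i j. (i, j) \<in> upper_pairs k \<Longrightarrow> V (i, j) \<in> carrier_mat (r i) (r j)"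
  shows "gauge_transform q (unipotent_mat r k F) (system_mat r k \<mu> A U) = system_mat r k \<mu> A V \<longleftrightarrow>
    (\<forall>(i, j)\<in>upper_pairs k.
      map_mat (sigma q) (F (i, j)) * (germ_zpow (- \<mu> j) \<cdot>\<^sub>m map_mat germ_const (A j)) +
        inhomogeneity q r U (\<lambda>e. (F e, V e)) (i, j) =
      (germ_zpow (- \<mu> i) \<cdot>\<^sub>m map_mat germ_const (A i)) * F (i, j) + V (i, j))"
proof -
  define D where "D = (\<lambda>i. germ_zpow (- \<mu> i) \<cdot>\<^sub>m map_mat germ_const (A i))"
  have D: "D i \<in> carrier_mat (r i) (r i)" if "i \<in> {1..k}" for i
    using A[OF that] by (simp add: D_def)
  define tri :: "(nat \<Rightarrow> germ mat) \<Rightarrow> (nat \<times> nat \<Rightarrow> germ mat) \<Rightarrow> nat \<Rightarrow> nat \<Rightarrow> germ mat" where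
    "tri = (\<lambda>E G i j. if i = j then E i else if i < j then G (i, j) else 0\<^sub>m (r i) (r j))"
  define S where "S = (\<lambda>e. map_mat (sigma q) (F e))"
  have S: "S (i, j) \<in> carrier_mat (r i) (r j)" if "(i, j) \<in> upper_pairs k" for i j
    using F[OF that] by (simp add: S_def)
  let ?I = "\<lambda>i. 1\<^sub>m (r i) :: germ mat"
  have tri: "tri E G i j \<in> carrier_mat (r i) (r j)"
    if "\<And>i. i \<in> {1..k} \<Longrightarrow> E i \<in> carrier_mat (r i) (r i)"
      and "\<And>i j. (i, j) \<in> upper_pairs k \<Longrightarrow> G (i, j) \<in> carrier_mat (r i) (r j)"
      and "i \<in> {1..k}" "j \<in> {1..k}" for E G i j
    using that by (auto simp: tri_def upper_pairs_def)
  have sys: "system_mat r k \<mu> A G = block_mat r k (tri D G)" for G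
    by (simp add: system_mat_def upper_block_mat_def tri_def D_def)
  have uni: "unipotent_mat r k F = block_mat r k (tri ?I F)"
    by (simp add: unipotent_mat_def upper_block_mat_def tri_def)
  have sigma_uni: "map_mat (sigma q) (unipotent_mat r k F) = block_mat r k (tri ?I S)"
  proof (rule eq_matI)
    fix a b assume "a < dim_row (block_mat r k (tri ?I S))" "b < dim_col (block_mat r k (tri ?I S))"
    then have ab: "a < (\<Sum>l=1..k. r l)" "b < (\<Sum>l=1..k. r l)" by (simp_all add: block_mat_def)
    note bp = block_of_pos[OF ab(1)] block_of_pos[OF ab(2)]
    have "map_mat (sigma q) (unipotent_mat r k F) $$ (a, b) = sigma q (block_mat r k (tri ?I F) $$ (a, b))"
      unfolding uni using ab by (simp add: block_mat_def)
    also have "\<dots> = block_mat r k (tri ?I S) $$ (a, b)"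
    proof (cases "block_of r a" "block_of r b" rule: linorder_cases)
      case less
      with bp have "(block_of r a, block_of r b) \<in> upper_pairs k" by (auto simp: upper_pairs_def)
      from F[OF this] show ?thesis
        unfolding block_mat_index[OF ab] using less bp by (simp add: tri_def S_def)
    qed (use bp in \<open>simp_all add: block_mat_index[OF ab] tri_def\<close>)
    finally show "map_mat (sigma q) (unipotent_mat r k F) $$ (a, b) = block_mat r k (tri ?I S) $$ (a, b)" .
  qed (simp_all add: uni block_mat_def)
  have one: "\<And>i. i \<in> {1..k} \<Longrightarrow> ?I i \<in> carrier_mat (r i) (r i)" by simp
  note cS = tri[OF one S] and cU = tri[OF D U] and cV = tri[OF D V] and cF = tri[OF one F]
  have tri0: "tri E G i j = 0\<^sub>m (r i) (r j)" if "j < i" for E G i j using that by (simp add: tri_def)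
  have "gauge_transform q (unipotent_mat r k F) (system_mat r k \<mu> A U) = system_mat r k \<mu> A V \<longleftrightarrow>
      block_mat r k (tri ?I S) * block_mat r k (tri D U) = block_mat r k (tri D V) * block_mat r k (tri ?I F)"
    unfolding gauge_transform_eq_iff[OF unipotent_mat_in_group block_mat_carrier block_mat_carrier] sys
      sigma_uni uni[symmetric] ..
  also have "\<dots> \<longleftrightarrow> (\<forall>i\<in>{1..k}. \<forall>j\<in>{1..k}. \<forall>a<r i. \<forall>b<r j.
       (\<Sum>l=1..k. (tri ?I S i l * tri D U l j) $$ (a, b)) = (\<Sum>l=1..k. (tri D V i l * tri ?I F l j) $$ (a, b)))"
    by (rule block_mat_mult_eq_iff) (use cS cU cV cF in blast)+
  also have "\<dots> \<longleftrightarrow> (\<forall>i\<in>{1..k}. \<forall>j\<in>{1..k}. i < j \<longrightarrow>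
      S (i, j) * D j + inhomogeneity q r U (\<lambda>e. (F e, V e)) (i, j) = D i * F (i, j) + V (i, j))"
  proof (intro ball_cong refl)
    fix i j assume ij: "i \<in> {1..k}" "j \<in> {1..k}"
    have L: "(\<Sum>l=1..k. (tri ?I S i l * tri D U l j) $$ (a, b)) =
      (if j < i then 0 else if i = j then (tri ?I S i i * tri D U i i) $$ (a, b)
       else (tri ?I S i i * tri D U i j) $$ (a, b) + (tri ?I S i j * tri D U j j) $$ (a, b) +
         (\<Sum>l\<in>{i<..<j}. (tri ?I S i l * tri D U l j) $$ (a, b)))"
      if "a < r i" "b < r j" for a b
      by (rule upper_triangular_block_product[where r = r]) (use cS cU tri0 ij that in blast)+
    have R: "(\<Sum>l=1..k. (tri D V i l * tri ?I F l j) $$ (a, b)) =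
      (if j < i then 0 else if i = j then (tri D V i i * tri ?I F i i) $$ (a, b)
       else (tri D V i i * tri ?I F i j) $$ (a, b) + (tri D V i j * tri ?I F j j) $$ (a, b) +
         (\<Sum>l\<in>{i<..<j}. (tri D V i l * tri ?I F l j) $$ (a, b)))"
      if "a < r i" "b < r j" for a b
      by (rule upper_triangular_block_product[where r = r]) (use cV cF tri0 ij that in blast)+
    show "(\<forall>a<r i. \<forall>b<r j. (\<Sum>l=1..k. (tri ?I S i l * tri D U l j) $$ (a, b)) =
        (\<Sum>l=1..k. (tri D V i l * tri ?I F l j) $$ (a, b))) \<longleftrightarrow>
      (i < j \<longrightarrow> S (i, j) * D j + inhomogeneity q r U (\<lambda>e. (F e, V e)) (i, j) = D i * F (i, j) + V (i, j))"
    proof (cases i j rule: linorder_cases)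
      case less
      then have up: "(i, j) \<in> upper_pairs k" using ij by (auto simp: upper_pairs_def)
      have c: "S (i, j) * D j \<in> carrier_mat (r i) (r j)" "D i * F (i, j) \<in> carrier_mat (r i) (r j)"
        "V (i, j) \<in> carrier_mat (r i) (r j)" "U (i, j) \<in> carrier_mat (r i) (r j)"
        using mult_carrier_mat[OF S[OF up] D[OF ij(2)]] mult_carrier_mat[OF D[OF ij(1)] F[OF up]]
          U[OF up] V[OF up] by auto
      have "(\<Sum>l=1..k. (tri ?I S i l * tri D U l j) $$ (a, b)) =
          (\<Sum>l=1..k. (tri D V i l * tri ?I F l j) $$ (a, b)) \<longleftrightarrow>
        (S (i, j) * D j + inhomogeneity q r U (\<lambda>e. (F e, V e)) (i, j)) $$ (a, b) =
          (D i * F (i, j) + V (i, j)) $$ (a, b)" if ab: "a < r i" "b < r j" for a b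
      proof -
        have dims: "dim_row (S (i, j) * D j) = r i" "dim_col (S (i, j) * D j) = r j"
          "dim_row (V (i, j)) = r i" "dim_col (V (i, j)) = r j"
          using carrier_matD[OF c(1)] carrier_matD[OF c(3)] by auto
        have l: "(\<Sum>l=1..k. (tri ?I S i l * tri D U l j) $$ (a, b)) =
            U (i, j) $$ (a, b) + (S (i, j) * D j) $$ (a, b) + (\<Sum>l\<in>{i<..<j}. (S (i, l) * U (l, j)) $$ (a, b))"
          unfolding L[OF ab] using less left_mult_one_mat[OF c(4)] by (simp add: tri_def del: index_mult_mat(1))
        have r: "(\<Sum>l=1..k. (tri D V i l * tri ?I F l j) $$ (a, b)) =
            (D i * F (i, j)) $$ (a, b) + V (i, j) $$ (a, b) + (\<Sum>l\<in>{i<..<j}. (V (i, l) * F (l, j)) $$ (a, b))"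
          unfolding R[OF ab] using less right_mult_one_mat[OF c(3)] by (simp add: tri_def del: index_mult_mat(1))
        have w: "(S (i, j) * D j + inhomogeneity q r U (\<lambda>e. (F e, V e)) (i, j)) $$ (a, b) =
            (S (i, j) * D j) $$ (a, b) + (U (i, j) $$ (a, b) + ((\<Sum>l\<in>{i<..<j}. (S (i, l) * U (l, j)) $$ (a, b)) -
              (\<Sum>l\<in>{i<..<j}. (V (i, l) * F (l, j)) $$ (a, b))))"
          using ab by (subst index_add_mat(1)) (simp_all add: inhomogeneity_def S_def sum_subtractf del: index_mult_mat(1))
        have v: "(D i * F (i, j) + V (i, j)) $$ (a, b) = (D i * F (i, j)) $$ (a, b) + V (i, j) $$ (a, b)"
          using ab dims by (intro index_add_mat(1)) simp_all
        show ?thesis unfolding l r w v by (simp add: algebra_simps del: index_mult_mat(1))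
      qed
      moreover have "dim_row (inhomogeneity q r U (\<lambda>e. (F e, V e)) (i, j)) = r i"
        "dim_col (inhomogeneity q r U (\<lambda>e. (F e, V e)) (i, j)) = r j"
        by (simp_all add: inhomogeneity_def)
      ultimately show ?thesis
        unfolding mat_eq_iff using less carrier_matD[OF c(3)] by (simp del: index_mult_mat(1) index_add_mat(1))
    next
      case equal
      have "1\<^sub>m (r j) * D j = D j * 1\<^sub>m (r j)" using D[OF ij(2)] by simp
      then show ?thesis using equal L R by (simp add: tri_def del: index_mult_mat(1))
    next
      case greater
      then show ?thesis using L R by simp
    qed
  qed
  also have "\<dots> \<longleftrightarrow> (\<forall>(i, j)\<in>upper_pairs k.
      S (i, j) * D j + inhomogeneity q r U (\<lambda>e. (F e, V e)) (i, j) = D i * F (i, j) + V (i, j))"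
    by (force simp: upper_pairs_def)
  finally show ?thesis unfolding S_def D_def .
qed

theorem proposition2p8:
  fixes q :: complex and k :: nat and r :: "nat \<Rightarrow> nat" and \<mu> :: "nat \<Rightarrow> int"
    and A :: "nat \<Rightarrow> complex mat" and U :: "nat \<times> nat \<Rightarrow> germ mat"
  assumes "norm q > 1"
    and "k \<ge> 1"
    and "\<And>i j. 1 \<le> i \<Longrightarrow> i < j \<Longrightarrow> j \<le> k \<Longrightarrow> \<mu> i > \<mu> j"
    and "\<And>i. i \<in> {1..k} \<Longrightarrow> r i \<ge> 1"
    and "\<And>i. i \<in> {1..k} \<Longrightarrow> A i \<in> carrier_mat (r i) (r i) \<and> invertible_mat (A i)"
    and "U \<in> block_families r k"
  shows "\<exists>!(F, V). F \<in> block_families r k \<and> V \<in> normal_form_families r k \<mu> \<and>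
           unipotent_mat r k F \<in> unipotent_group r k \<and>
           gauge_transform q (unipotent_mat r k F) (system_mat r k \<mu> A U) = system_mat r k \<mu> A V"
proof -
  define E where "E = (\<lambda>f i j X Y. X \<in> carrier_mat (r i) (r j) \<and> Y \<in> normal_form_space (r i) (r j) (\<mu> i) (\<mu> j) \<and>
    map_mat (sigma q) X * (germ_zpow (- \<mu> j) \<cdot>\<^sub>m map_mat germ_const (A j)) + inhomogeneity q r U f (i, j) =
    (germ_zpow (- \<mu> i) \<cdot>\<^sub>m map_mat germ_const (A i)) * X + Y)"
  \<comment> \<open>Off the index set, \<open>P\<close> forces the default value \<open>undefined\<close>, so that the solution is an extensional family.\<close>
  define P where "P = (\<lambda>f x s. if x \<in> upper_pairs k then E f (fst x) (snd x) (fst s) (snd s)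
    else s = (undefined, undefined))"
  define Q where "Q = (\<lambda>F V. F \<in> block_families r k \<and> V \<in> normal_form_families r k \<mu> \<and>
    unipotent_mat r k F \<in> unipotent_group r k \<and>
    gauge_transform q (unipotent_mat r k F) (system_mat r k \<mu> A U) = system_mat r k \<mu> A V)"
  have "\<exists>!f. \<forall>x. P f x (f x)"
  proof (rule ex1_wf_recursive_family)
    show "wf (Wellfounded.measure (\<lambda>(i, j). j - i) :: ((nat \<times> nat) \<times> (nat \<times> nat)) set)" by simp
  next
    fix f g :: "nat \<times> nat \<Rightarrow> germ mat \<times> germ mat" and x :: "nat \<times> nat" and s
    assume eq: "\<And>y. (y, x) \<in> Wellfounded.measure (\<lambda>(i, j). j - i) \<Longrightarrow> f y = g y"
    obtain i j where x: "x = (i, j)" by (cases x)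
    have "f (i, l) = g (i, l)" "f (l, j) = g (l, j)" if "l \<in> {i<..<j}" for l
      using that by (auto intro!: eq simp: x)
    then have "inhomogeneity q r U f (i, j) = inhomogeneity q r U g (i, j)"
      unfolding inhomogeneity_def by (auto intro!: eq_matI sum.cong)
    then show "P f x s = P g x s" by (simp add: P_def E_def x)
  next
    fix f :: "nat \<times> nat \<Rightarrow> germ mat \<times> germ mat" and x :: "nat \<times> nat"
    obtain i j where x: "x = (i, j)" by (cases x)
    show "\<exists>!s. P f x s"
    proof (cases "x \<in> upper_pairs k")
      case True
      then have ij: "1 \<le> i" "i < j" "j \<le> k" by (auto simp: x upper_pairs_def)
      then have "\<exists>!(X, Y). E f i j X Y"
        unfolding E_def using assms(1,3,5) by (intro two_block_normal_form) auto
      then show ?thesis using True by (simp add: P_def x case_prod_unfold)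
    qed (simp add: P_def)
  qed
  moreover have Q_iff: "Q F V \<longleftrightarrow> (\<forall>x. P (\<lambda>e. (F e, V e)) x (F x, V x))" for F V
  proof -
    have "F \<in> block_families r k \<and> V \<in> normal_form_families r k \<mu> \<longleftrightarrow>
      (\<forall>i j. if (i, j) \<in> upper_pairs k
         then F (i, j) \<in> carrier_mat (r i) (r j) \<and> V (i, j) \<in> normal_form_space (r i) (r j) (\<mu> i) (\<mu> j)
         else F (i, j) = undefined \<and> V (i, j) = undefined)"
      unfolding block_families_def normal_form_families_def PiE_iff extensional_def by auto
    moreover have "gauge_transform q (unipotent_mat r k F) (system_mat r k \<mu> A U) = system_mat r k \<mu> A V \<longleftrightarrow>
      (\<forall>(i, j)\<in>upper_pairs k.
        map_mat (sigma q) (F (i, j)) * (germ_zpow (- \<mu> j) \<cdot>\<^sub>m map_mat germ_const (A j)) +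
          inhomogeneity q r U (\<lambda>e. (F e, V e)) (i, j) =
        (germ_zpow (- \<mu> i) \<cdot>\<^sub>m map_mat germ_const (A i)) * F (i, j) + V (i, j))"
      if "F \<in> block_families r k" "V \<in> normal_form_families r k \<mu>"
    proof (rule gauge_equation_iff_blocks)
      show "A i \<in> carrier_mat (r i) (r i)" if "i \<in> {1..k}" for i using assms(5)[OF that] by simp
    qed (use that assms(6) in \<open>auto simp: block_families_def normal_form_families_def normal_form_space_def PiE_iff\<close>)
    ultimately show ?thesis
      unfolding Q_def P_def E_def using unipotent_mat_in_group[of r k F]
      by (fastforce split: if_splits)
  qed
  ultimately obtain f where f: "\<forall>x. P f x (f x)" and uniq: "\<And>g. \<forall>x. P g x (g x) \<Longrightarrow> g = f" by blast
  have "\<exists>!(F, V). Q F V"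
  proof (intro ex1I[of _ "(fst \<circ> f, snd \<circ> f)"])
    show "case (fst \<circ> f, snd \<circ> f) of (F, V) \<Rightarrow> Q F V" using f by (simp add: Q_iff)
  next
    fix FV assume FV: "case FV of (F, V) \<Rightarrow> Q F V"
    obtain F V where FV': "FV = (F, V)" by (cases FV)
    from FV have "\<forall>x. P (\<lambda>e. (F e, V e)) x (F x, V x)" by (simp add: FV' Q_iff)
    from uniq[OF this] show "FV = (fst \<circ> f, snd \<circ> f)" by (auto simp: FV')
  qed
  then show ?thesis unfolding Q_def .
qed

end
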